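(* Let $p=(p_0,p_1,\ldots)$ be a critical offspring distribution (mean $1$, $p_1\ne1$), let $\tau$ be a Galton-Watson tree with offspring distribution $p$, and $\tau^{(k)}=(\tau_1,\ldots,\tau_k)$ a forest of $k$ i.i.d. copies of $\tau$. Let $A$ be a $\mathbb{Z}_+$-valued function on the space of finite forests, and write $\mathbf{P}[A>n]=\mathbf{P}[A(\tau)>n]$ and $\mathbf{P}^{(k)}[A>n]=\mathbf{P}[A(\tau^{(k)})>n]$. Assume that $\mathbf{P}[A>n]>0$ for all $n$ and that $A$ satisfies the monotonicity property $$A(\mathbf{t}_{(b),i})\le A(\mathbf{t}_{(b)})\le A(\mathbf{t})\quad\text{for all }\mathbf{t}\in\mathbb{T}_0,\ b\in\mathbb{N},\ 1\le i\le Y_b(\mathbf{t}).$$ Then for every $k\in\mathbb{N}$, $$\lim_{n\to\infty}\frac{\mathbf{P}^{(k)}[A>n]}{\mathbf{P}[A>n]}=k.$$ Assume additionally that for some $b\in\mathbb{N}$, some $\mathbf{s}\in\mathbb{T}^{(b)}$ with $\mathbf{P}[r_b(\tau)=\mathbf{s}]>0$, and some $r_0>0$, one has $A(\mathbf{t})-A(\mathbf{t}_{(b)})=r_0$ for large enough $A(\mathbf{t})$ with $r_b(\mathbf{t})=\mathbf{s}$ (i.e. there is $n_0$ such that the equality holds for all $\mathbf{t}\in\mathbb{T}_0$ with $r_b(\mathbf{t})=\mathbf{s}$ and $A(\mathbf{t})\ge n_0$). Then for all $k\in\mathbb{N}$ and $r\in\mathbb{N}$, $$\lim_{n\to\inf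ty}\frac{\mathbf{P}^{(k)}[A>n-r]}{\mathbf{P}^{(k)}[A>n]}=1.$$
   Context: $\mathbb{Z}_+=\{0,1,2,\ldots\}$, $\mathbb{N}=\{1,2,\ldots\}$. Trees are rooted ordered trees in Neveu's formalism: a tree $\mathbf{t}$ is a set of finite sequences of positive integers containing the empty sequence $\emptyset$ (the root), closed under taking prefixes, such that for each $u\in\mathbf{t}$ there is $k_u(\mathbf{t})\in\mathbb{Z}_+$ (the out-degree) with $ui\in\mathbf{t}$ iff $1\le i\le k_u(\mathbf{t})$. $|u|$ is the length (height) of $u$. $\mathbb{T}_0$ is the set of finite trees, $\mathbb{T}^{(b)}$ the set of trees all of whose nodes have height at most $b$, $r_b(\mathbf{t})=\{u\in\mathbf{t}:|u|\le b\}$. A finite forest is a finite collection $(\mathbf{t}_1,\ldots,\mathbf{t}_k)$ of finite trees; a finite tree is regarded as a forest with one tree. $Y_b(\mathbf{t})$ is the number of nodes of $\mathbf{t}$ at height $b$; $\mathbf{t}_{(b)}=(\mathbf{t}_{(b),i},1\le i\le Y_b(\mathbf{t}))$ is the forest of subtrees above height $b$: if $u_1,u_2,\ldots$ are the nodes at height $b$ in order, $\mathbf{t}_{(b),i}=\{v:u_iv\in\mathbf{t}\}$. A Galton-Watson tree $\tau$ with offspring distribution $p$ is a random tree in which the out-degree of the root has law $p$ and, conditionally on it being $n$, the $n$ subtrees above height 1 are independent and distributed as $\tau$; in the critical case with $p_1\neq 1$, $\tau\in\mathbb{T}_0$ a.s.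
   Formalization: The formal theorem requires s to have a node at height b, and covers those k for which P[Y_b(τ)=k]>0 for some b≥0, or all k if A never decreases when trees are appended to a nonempty forest; without these conditions the literal claims fail. *)

theory Defs
  imports "HOL-Probability.Probability" "HOL-Library.List_Lexorder"
begin

type_synonym tree = "nat list set"
type_synonym forest = "tree list"

definition trees :: "tree set" where
  "trees = {t. [] \<in> t
     \<and> (\<forall>u\<in>t. \<forall>i\<in>set u. 1 \<le> i)
     \<and> (\<forall>u v. u @ v \<in> t \<longrightarrow> u \<in> t)
     \<and> (\<forall>u\<in>t. \<exists>k. \<forall>i. u @ [i] \<in> t \<longleftrightarrow> 1 \<le> i \<and> i \<le> k)}"

definition outdeg :: "tree \<Rightarrow> nat list \<Rightarrow> nat" where
  "outdeg t u = (THE k. \<forall>i. u @ [i] \<in> t \<longleftrightarrow> 1 \<le> i \<and> i \<le> k)"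

definition finite_trees :: "tree set" where
  "finite_trees = {t \<in> trees. finite t}"

definition trees_upto :: "nat \<Rightarrow> tree set" where
  "trees_upto b = {t \<in> trees. \<forall>u\<in>t. length u \<le> b}"

definition truncate :: "nat \<Rightarrow> tree \<Rightarrow> tree" where
  "truncate b t = {u \<in> t. length u \<le> b}"

definition level :: "nat \<Rightarrow> tree \<Rightarrow> nat list set" where
  "level b t = {u \<in> t. length u = b}"

definition Y_at :: "nat \<Rightarrow> tree \<Rightarrow> nat" where
  "Y_at b t = card (level b t)"

definition subtree :: "tree \<Rightarrow> nat list \<Rightarrow> tree" where
  "subtree t u = {v. u @ v \<in> t}"

text \<open>The nodes of a level are listed in lexicographic order, the linear order on
  lists provided by \<^theory>\<open>HOL-Library.List_Lexorder\<close>. List positions start at 0,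
  so the \<open>i\<close>-th subtree above height \<open>b\<close> is \<open>above b t ! (i - 1)\<close>.\<close>

definition above :: "nat \<Rightarrow> tree \<Rightarrow> forest" where
  "above b t = map (subtree t) (sorted_list_of_set (level b t))"

text \<open>The usual sigma-algebra on the set of all (possibly infinite) trees: the one that
  makes every truncation measurable.\<close>

definition tree_space :: "tree measure" where
  "tree_space = sigma trees {{t \<in> trees. truncate h t = s} |h s. s \<in> trees_upto h}"

definition galton_watson :: "nat pmf \<Rightarrow> 'a measure \<Rightarrow> ('a \<Rightarrow> tree) \<Rightarrow> bool" where
  "galton_watson p M \<tau> \<longleftrightarrow>
     \<tau> \<in> measurable M tree_space
   \<and> (\<forall>n. \<P>(\<omega> in M. outdeg (\<tau> \<omega>) [] = n) = pmf p n)
   \<and> (\<forall>n B. pmf p n > 0 \<longrightarrow> (\<forall>i\<in>{1..n}. B i \<in> sets tree_space) \<longrightarrow>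
        \<P>(\<omega> in M. (\<forall>i\<in>{1..n}. subtree (\<tau> \<omega>) [i] \<in> B i) \<bar> outdeg (\<tau> \<omega>) [] = n)
          = (\<Prod>i\<in>{1..n}. \<P>(\<omega> in M. \<tau> \<omega> \<in> B i)))"

definition critical :: "nat pmf \<Rightarrow> bool" where
  "critical p \<longleftrightarrow> integrable (measure_pmf p) real \<and> measure_pmf.expectation p real = 1"

definition iid_copies :: "'a measure \<Rightarrow> ('a \<Rightarrow> tree) \<Rightarrow> nat \<Rightarrow> (nat \<Rightarrow> 'a \<Rightarrow> tree) \<Rightarrow> bool" where
  "iid_copies M \<tau> k \<sigma> \<longleftrightarrow>
     prob_space.indep_vars M (\<lambda>_. tree_space) \<sigma> {1..k}
   \<and> (\<forall>i\<in>{1..k}. distr M tree_space (\<sigma> i) = distr M tree_space \<tau>)"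

definition forest_of :: "nat \<Rightarrow> (nat \<Rightarrow> 'a \<Rightarrow> tree) \<Rightarrow> 'a \<Rightarrow> forest" where
  "forest_of k \<sigma> \<omega> = map (\<lambda>i. \<sigma> i \<omega>) [1..<Suc k]"

text \<open>The probability that \<open>A(F) > x\<close> for a random forest \<open>F\<close>. The function \<open>A\<close> is
  meaningful on finite forests only, so the event includes finiteness of all trees; for
  critical Galton-Watson trees this holds almost surely. The threshold is an integer so that
  \<open>n - r\<close> is not truncated.\<close>

definition tail :: "'a measure \<Rightarrow> (forest \<Rightarrow> nat) \<Rightarrow> ('a \<Rightarrow> forest) \<Rightarrow> int \<Rightarrow> real" where
  "tail M A F x = \<P>(\<omega> in M. set (F \<omega>) \<subseteq> finite_trees \<and> int (A (F \<omega>)) > x)"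

definition monotone_functional :: "(forest \<Rightarrow> nat) \<Rightarrow> bool" where
  "monotone_functional A \<longleftrightarrow>
     (\<forall>t\<in>finite_trees. \<forall>b\<ge>1. \<forall>i\<in>{1..Y_at b t}.
        A [above b t ! (i - 1)] \<le> A (above b t) \<and> A (above b t) \<le> A [t])"

text \<open>The additivity hypothesis of the second limit. The requirement \<open>Y_at b s \<ge> 1\<close> says that
  the forest above height \<open>b\<close> is nonempty; otherwise \<open>truncate b t = s\<close> forces \<open>t = s\<close>,
  the clause on large \<open>A [t]\<close> is void (take \<open>n0 > A [s]\<close>), and the second limit may fail:
  let \<open>s\<close> be the one-node tree, \<open>b = 1\<close>, and let \<open>A\<close> be the height rounded up to a power of 2.\<close>

definition eventually_additive ::
  "'a measure \<Rightarrow> ('a \<Rightarrow> tree) \<Rightarrow> (forest \<Rightarrow> nat) \<Rightarrow> bool" where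
  "eventually_additive M \<tau> A \<longleftrightarrow>
     (\<exists>b\<ge>1. \<exists>s\<in>trees_upto b. \<exists>r0::int. r0 > 0
      \<and> Y_at b s \<ge> 1
      \<and> \<P>(\<omega> in M. truncate b (\<tau> \<omega>) = s) > 0
      \<and> (\<exists>n0. \<forall>t\<in>finite_trees. truncate b t = s \<longrightarrow> A [t] \<ge> n0 \<longrightarrow>
            int (A [t]) - int (A (above b t)) = r0))"

text \<open>For a forest of \<open>k\<close> trees, the monotonicity property relates \<open>A\<close> to the law of \<open>\<tau>\<close>
  only if \<open>k\<close> is a possible size of a generation of \<open>\<tau>\<close>, or if forests of size \<open>k\<close> can be
  compared with larger ones. Without such a link both limits may fail. For the first one take
  offspring 0 or 2 with probability 1/2 each and \<open>k = 3\<close>; let \<open>A\<close> be the height on forests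
  of 1 or an even number of trees all of whose out-degrees are 0 or 2, and twice the height on
  all other forests. Then the monotonicity property holds, but the ratio tends to 6.\<close>

definition accessible_size ::
  "'a measure \<Rightarrow> ('a \<Rightarrow> tree) \<Rightarrow> (forest \<Rightarrow> nat) \<Rightarrow> nat \<Rightarrow> bool" where
  "accessible_size M \<tau> A k \<longleftrightarrow>
     (\<exists>b. \<P>(\<omega> in M. Y_at b (\<tau> \<omega>) = k) > 0)
   \<or> (\<forall>f g. set f \<subseteq> finite_trees \<longrightarrow> set g \<subseteq> finite_trees \<longrightarrow> f \<noteq> [] \<longrightarrow> A f \<le> A (f @ g))"

end

theory Submission
  imports Defs
begin

text \<open>
  A critical Galton-Watson tree is almost surely finite. Indeed \<open>q = P(\<tau> finite)\<close> satisfies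
  \<open>q = \<Sum>n. p n * q ^ n\<close>, while \<open>q ^ n \<ge> 1 - n * (1 - q)\<close> with strict inequality for
  \<open>n \<ge> 2\<close> and \<open>q < 1\<close>; as \<open>p\<close> has mean 1 and charges some \<open>n \<ge> 2\<close>, this forces \<open>q = 1\<close>
  (\<open>prob_finite\<close>). Hence everything happens on the countable set of finite trees, and \<open>\<tau>\<close> may be
  replaced by a discrete law \<open>W\<close> with
  \<open>W = (choose k from p, then plant k independent samples of W on a common root)\<close>.
  Induction on \<open>b\<close> then yields the branching property: given the truncation of the tree at
  height \<open>b\<close>, the subtrees above height \<open>b\<close> are independent samples of \<open>W\<close>, and their number
  \<open>Y b\<close> has mean 1.

  Write \<open>a n\<close> for the tail of \<open>A\<close> on one tree, \<open>a k n\<close> for its tail on \<open>k\<close> independent trees, and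
  \<open>y k n = 1 - (1 - a n) ^ k\<close> for the probability that one of \<open>k\<close> independent trees has a value of
  \<open>A\<close> above \<open>n\<close>. Every forest is the forest above height 1 of some tree, so monotonicity gives
  \<open>A f \<ge> A [t]\<close> for each tree \<open>t\<close> of \<open>f\<close>, and thus \<open>a k n \<ge> y k n\<close>, where \<open>y k n / a n\<close> tends
  to \<open>k\<close>. The upper bound comes from the mean of \<open>Y b\<close> (\<open>generation_bound\<close>). For \<open>b \<ge> 1\<close> let \<open>S\<close> be
  an event of positive probability that depends on the truncation at height \<open>b\<close> only and on which
  \<open>Y b = m\<close>. On \<open>S\<close> keep an event \<open>Z\<close> for the forest above \<open>b\<close> that forces \<open>A > n\<close>;
  off \<open>S\<close> keep only the event that one of the subtrees has a value above \<open>n\<close>. This gives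
  \<open>a n \<ge> P(S) * P(Z) + E[y (Y b) n; not S]\<close>. After division by \<open>a n\<close> the last term tends to
  \<open>E[Y b; not S] = 1 - m * P(S)\<close> by dominated convergence, so the upper limit of \<open>P(Z) / a n\<close>
  is at most \<open>m\<close>.

  With \<open>S = {Y b = k}\<close> and \<open>Z = {A > n}\<close> this is the first limit when \<open>k\<close> is a possible
  generation size. If instead \<open>A\<close> does not decrease when a forest is extended, take a possible
  generation size \<open>m \<ge> k\<close> and use
  \<open>1 - a m n \<le> (1 - a k n) * (1 - y (m - k) n)\<close>. With \<open>S = {the truncation is s}\<close> and
  \<open>Z = {A > n - r0}\<close>, the additivity hypothesis makes \<open>Z\<close> force \<open>A > n\<close> for large \<open>n\<close>; together with \<open>a m \<ge> y m\<close> the bound yields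
  \<open>a (n - r0) / a n \<longlonglongrightarrow> 1\<close>; iteration and the first limit give the second one.
\<close>

section \<open>Trees built from forests\<close>

text \<open>The tree whose root has the trees of the given forest as its subtrees above height 1, in
  order. Children are numbered from 1 and list positions from 0, hence the \<open>Suc\<close>.\<close>
definition plant :: "forest \<Rightarrow> tree" where
  "plant f = insert [] {Suc i # u | i u. i < length f \<and> u \<in> f ! i}"

lemma Nil_in_plant [simp]: "[] \<in> plant f"
  by (simp add: plant_def)

lemma Cons_in_plant: "j # u \<in> plant f \<longleftrightarrow> (\<exists>i. j = Suc i \<and> i < length f \<and> u \<in> f ! i)"
  by (auto simp: plant_def)

lemma Nil_in_tree: "t \<in> trees \<Longrightarrow> [] \<in> t"
  by (simp add: trees_def)

lemma plant_in_trees: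
  assumes "set f \<subseteq> trees"
  shows "plant f \<in> trees"
proof -
  have f: "f ! i \<in> trees" if "i < length f" for i
    using assms nth_mem[OF that] by blast
  have pos: "1 \<le> i" if "u \<in> plant f" "i \<in> set u" for u i
  proof (cases u)
    case (Cons j v)
    with that obtain l where l: "j = Suc l" "l < length f" "v \<in> f ! l"
      by (auto simp: Cons_in_plant)
    then show ?thesis
      using f[OF l(2)] that(2) Cons by (auto simp: trees_def)
  qed (use that in simp)
  have pre: "u \<in> plant f" if "u @ v \<in> plant f" for u v
  proof (cases u)
    case (Cons j w)
    with that obtain l where l: "j = Suc l" "l < length f" "w @ v \<in> f ! l"
      by (auto simp: Cons_in_plant)
    then have "w \<in> f ! l"
      using f[OF l(2)] unfolding trees_def by blast
    with l Cons show ?thesis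
      by (auto simp: Cons_in_plant)
  qed simp
  have deg: "\<exists>k. \<forall>i. u @ [i] \<in> plant f \<longleftrightarrow> 1 \<le> i \<and> i \<le> k" if "u \<in> plant f" for u
  proof (cases u)
    case Nil
    have "u @ [i] \<in> plant f \<longleftrightarrow> 1 \<le> i \<and> i \<le> length f" for i
      using f Nil_in_tree unfolding Nil by (cases i) (auto simp: Cons_in_plant)
    then show ?thesis
      by blast
  next
    case (Cons j w)
    with that obtain l where l: "j = Suc l" "l < length f" "w \<in> f ! l"
      by (auto simp: Cons_in_plant)
    then obtain k where "\<And>i. w @ [i] \<in> f ! l \<longleftrightarrow> 1 \<le> i \<and> i \<le> k"
      using f[OF l(2)] unfolding trees_def by blast
    with l Cons show ?thesis
      by (auto simp: Cons_in_plant)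
  qed
  show ?thesis
    unfolding trees_def mem_Collect_eq using pos pre deg Nil_in_plant by simp
qed

lemma plant_in_finite_trees:
  assumes "set f \<subseteq> finite_trees"
  shows "plant f \<in> finite_trees"
proof -
  have "plant f = insert [] (\<Union>i<length f. (#) (Suc i) ` (f ! i))"
    by (auto simp: plant_def)
  moreover have "finite (f ! i)" if "i < length f" for i
    using assms nth_mem[OF that] by (auto simp: finite_trees_def)
  ultimately have "finite (plant f)"
    by simp
  then show ?thesis
    using plant_in_trees[of f] assms by (auto simp: finite_trees_def)
qed

lemma outdeg_eqI:
  assumes "\<And>i. u @ [i] \<in> t \<longleftrightarrow> 1 \<le> i \<and> i \<le> k"
  shows "outdeg t u = k"
  unfolding outdeg_def
proof (rule the_equality)
  show "\<forall>i. u @ [i] \<in> t \<longleftrightarrow> 1 \<le> i \<and> i \<le> k"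
    using assms by blast
  fix l assume "\<forall>i. u @ [i] \<in> t \<longleftrightarrow> 1 \<le> i \<and> i \<le> l"
  with assms have eq: "1 \<le> i \<and> i \<le> k \<longleftrightarrow> 1 \<le> i \<and> i \<le> l" for i
    by blast
  show "l = k"
    using eq[of k] eq[of l] by linarith
qed

lemma outdeg_plant:
  assumes "set f \<subseteq> trees"
  shows "outdeg (plant f) [] = length f"
proof (rule outdeg_eqI)
  fix i
  have "[] \<in> f ! j" if "j < length f" for j
    using assms nth_mem[OF that] Nil_in_tree by blast
  then show "[] @ [i] \<in> plant f \<longleftrightarrow> 1 \<le> i \<and> i \<le> length f"
    by (cases i) (auto simp: Cons_in_plant)
qed

lemma subtree_plant: "i < length f \<Longrightarrow> subtree (plant f) [Suc i] = f ! i"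
  by (auto simp: subtree_def Cons_in_plant)

lemma subtree_in_trees:
  assumes "t \<in> trees" "u \<in> t"
  shows "subtree t u \<in> trees"
proof -
  have "[] \<in> subtree t u"
    using assms by (simp add: subtree_def)
  moreover have "\<forall>v\<in>subtree t u. \<forall>i\<in>set v. 1 \<le> i"
    using assms(1) by (fastforce simp: subtree_def trees_def)
  moreover have "\<forall>v w. v @ w \<in> subtree t u \<longrightarrow> v \<in> subtree t u"
  proof (intro allI impI)
    fix v w assume "v @ w \<in> subtree t u"
    then have "(u @ v) @ w \<in> t"
      by (simp add: subtree_def)
    then have "u @ v \<in> t"
      using assms(1) unfolding trees_def by blast
    then show "v \<in> subtree t u"
      by (simp add: subtree_def)
  qed
  moreover have "\<forall>v\<in>subtree t u. \<exists>k. \<forall>i. v @ [i] \<in> subtree t u \<longleftrightarrow> 1 \<le> i \<and> i \<le> k"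
  proof
    fix v assume "v \<in> subtree t u"
    then have "u @ v \<in> t"
      by (simp add: subtree_def)
    then obtain k where "\<forall>i. (u @ v) @ [i] \<in> t \<longleftrightarrow> 1 \<le> i \<and> i \<le> k"
      using assms(1) unfolding trees_def by blast
    then show "\<exists>k. \<forall>i. v @ [i] \<in> subtree t u \<longleftrightarrow> 1 \<le> i \<and> i \<le> k"
      by (auto simp: subtree_def)
  qed
  ultimately show ?thesis
    unfolding trees_def by blast
qed

lemma root_children:
  assumes "t \<in> trees"
  shows "[i] \<in> t \<longleftrightarrow> 1 \<le> i \<and> i \<le> outdeg t []"
proof -
  obtain k where k: "\<And>i. [] @ [i] \<in> t \<longleftrightarrow> 1 \<le> i \<and> i \<le> k"
    using assms unfolding trees_def by blast
  with outdeg_eqI[OF k] show ?thesis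
    by simp
qed

text \<open>Every tree, finite or not, arises by planting the subtrees of the children of its root.\<close>
lemma tree_eq_plant:
  assumes "t \<in> trees"
  shows "t = plant (map (\<lambda>i. subtree t [Suc i]) [0..<outdeg t []])"
proof (rule set_eqI)
  fix u
  show "u \<in> t \<longleftrightarrow> u \<in> plant (map (\<lambda>i. subtree t [Suc i]) [0..<outdeg t []])"
  proof (cases u)
    case Nil
    then show ?thesis
      using Nil_in_tree[OF assms] by simp
  next
    case (Cons j v)
    have "[j] \<in> t" if "j # v \<in> t"
      using assms that unfolding trees_def by (metis (mono_tags, lifting) append_Cons append_Nil mem_Collect_eq)
    then show ?thesis
      using root_children[OF assms, of j] unfolding Cons
      by (cases j) (auto simp: Cons_in_plant subtree_def)
  qed
qed

lemma finite_tree_cases: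
  assumes "t \<in> finite_trees"
  obtains f where "set f \<subseteq> finite_trees" "t = plant f"
proof -
  let ?f = "map (\<lambda>i. subtree t [Suc i]) [0..<outdeg t []]"
  have t: "t \<in> trees" "finite t"
    using assms by (auto simp: finite_trees_def)
  have "subtree t [Suc i] \<in> finite_trees" if "i < outdeg t []" for i
  proof -
    have "[Suc i] \<in> t"
      using that root_children[OF t(1)] by simp
    moreover have "subtree t [Suc i] \<subseteq> tl ` t"
      by (force simp: subtree_def)
    then have "finite (subtree t [Suc i])"
      using t(2) finite_surj by blast
    ultimately show ?thesis
      using subtree_in_trees[OF t(1)] by (simp add: finite_trees_def)
  qed
  then have "set ?f \<subseteq> finite_trees"
    by auto
  then show thesis
    using that tree_eq_plant[OF t(1)] by blast
qed

lemma finite_trees_subset: "finite_trees \<subseteq> trees"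
  by (auto simp: finite_trees_def)

lemma plant_inject:
  assumes "set f \<subseteq> trees" "set g \<subseteq> trees"
  shows "plant f = plant g \<longleftrightarrow> f = g"
proof
  assume eq: "plant f = plant g"
  then have len: "length f = length g"
    using outdeg_plant[OF assms(1)] outdeg_plant[OF assms(2)] by simp
  moreover have "f ! i = g ! i" if "i < length f" for i
    using subtree_plant[of i f] subtree_plant[of i g] eq that len by simp
  ultimately show "f = g"
    by (intro nth_equalityI) auto
qed simp

lemma truncate_0: "t \<in> trees \<Longrightarrow> truncate 0 t = {[]}"
  using Nil_in_tree by (auto simp: truncate_def)

lemma above_0: "t \<in> trees \<Longrightarrow> above 0 t = [t]"
proof -
  assume "t \<in> trees"
  then have "level 0 t = {[]}"
    using Nil_in_tree by (auto simp: level_def)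
  then show ?thesis
    by (simp add: above_def subtree_def)
qed

lemma truncate_plant: "truncate (Suc b) (plant f) = plant (map (truncate b) f)"
proof (rule set_eqI)
  show "u \<in> truncate (Suc b) (plant f) \<longleftrightarrow> u \<in> plant (map (truncate b) f)" for u
    by (cases u) (auto simp: truncate_def Cons_in_plant)
qed

lemma level_truncate: "level b (truncate b t) = level b t"
  by (auto simp: level_def truncate_def)

lemma Y_at_truncate: "Y_at b (truncate b t) = Y_at b t"
  by (simp add: Y_at_def level_truncate)

text \<open>Lexicographic order compares the first entries first, so the nodes at height \<open>b + 1\<close> are
  listed subtree by subtree. This is what makes \<open>above\<close> compatible with planting.\<close>
lemma sorted_list_of_level_plant:
  assumes "set f \<subseteq> finite_trees"
  shows "sorted_list_of_set (level (Suc b) (plant f)) =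
    concat (map (\<lambda>i. map ((#) (Suc i)) (sorted_list_of_set (level b (f ! i)))) [0..<length f])"
    (is "_ = ?xs (length f)")
proof -
  have fin: "finite (level b (f ! i))" if "i < length f" for i
    using assms nth_mem[OF that] by (auto simp: level_def finite_trees_def)
  have "sorted_wrt (<) (?xs n)" if "n \<le> length f" for n
    using that
  proof (induction n)
    case (Suc n)
    have "sorted_wrt (<) (sorted_list_of_set (level b (f ! n)))"
      by (rule strict_sorted_list_of_set)
    moreover have "finite (level b (f ! i))" if "i \<le> n" for i
      using fin Suc.prems that by auto
    ultimately show ?case
      using Suc by (auto simp: sorted_wrt_append sorted_wrt_map)
  qed simp
  moreover have "set (?xs (length f)) = level (Suc b) (plant f)"
  proof (rule set_eqI)
    show "u \<in> set (?xs (length f)) \<longleftrightarrow> u \<in> level (Suc b) (plant f)" for u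
      using fin by (cases u) (auto simp: level_def Cons_in_plant image_iff)
  qed
  ultimately show ?thesis
    using sorted_list_of_set.idem_if_sorted_distinct[of "?xs (length f)"]
    by (simp add: strict_sorted_iff)
qed

lemma above_plant:
  assumes "set f \<subseteq> finite_trees"
  shows "above (Suc b) (plant f) = concat (map (above b) f)"
proof -
  have "map (subtree (plant f)) (map ((#) (Suc i)) xs) = map (subtree (f ! i)) xs"
    if "i < length f" for i xs
    using that by (auto simp: subtree_def Cons_in_plant)
  then have "above (Suc b) (plant f) =
      concat (map (\<lambda>i. above b (f ! i)) [0..<length f])"
    unfolding above_def sorted_list_of_level_plant[OF assms] map_concat map_map o_def
    by (intro arg_cong[where f=concat] map_cong) auto
  also have "map (\<lambda>i. above b (f ! i)) [0..<length f] = map (above b) f"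
    by (rule nth_equalityI) auto
  finally show ?thesis .
qed

lemma length_above: "length (above b t) = Y_at b t"
  by (simp add: above_def Y_at_def)

lemma above_1_plant: "set f \<subseteq> finite_trees \<Longrightarrow> above 1 (plant f) = f"
proof -
  assume f: "set f \<subseteq> finite_trees"
  then have "map (above 0) f = map (\<lambda>t. [t]) f"
    using above_0 finite_trees_subset by (intro map_cong) auto
  with above_plant[OF f, of 0] show ?thesis
    by (simp only: concat_map_singleton One_nat_def map_ident)
qed

lemma countable_finite_trees: "countable finite_trees"
proof (rule countable_subset)
  show "finite_trees \<subseteq> {t. finite t}"
    by (auto simp: finite_trees_def)
  show "countable {t :: nat list set. finite t}"
    using countable_Collect_finite by blast
qed

section \<open>Independent samples and the branching property\<close>

text \<open>The inductive step of the branching property. Suppose that the law of \<open>(cut t, up t)\<close> does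
  not change when \<open>up t\<close> is replaced by a list of \<open>y t\<close> fresh independent samples. Then the same
  holds for \<open>k\<close> independent samples, with the lists \<open>up t\<close> concatenated and the numbers \<open>y t\<close> added.\<close>
lemma map_pmf_replicate_pmf_concat:
  fixes W :: "'t pmf" and cut :: "'t \<Rightarrow> 's" and up :: "'t \<Rightarrow> 't list" and y :: "'t \<Rightarrow> nat"
  assumes "map_pmf (\<lambda>t. (cut t, up t)) W = bind_pmf W (\<lambda>t. map_pmf (Pair (cut t)) (replicate_pmf (y t) W))"
  shows "map_pmf (\<lambda>f. (map cut f, concat (map up f))) (replicate_pmf k W) =
    bind_pmf (replicate_pmf k W)
      (\<lambda>f. map_pmf (Pair (map cut f)) (replicate_pmf (sum_list (map y f)) W))"
proof (induction k)
  case 0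
  show ?case
    by (simp add: bind_return_pmf)
next
  case (Suc k)
  let ?R = "\<lambda>n. replicate_pmf n W"
  let ?j = "\<lambda>(s, a). \<lambda>(ss, as). (s # ss, a @ as)"
  have "map_pmf (\<lambda>f. (map cut f, concat (map up f))) (?R (Suc k)) =
    bind_pmf (map_pmf (\<lambda>t. (cut t, up t)) W) (\<lambda>q.
      map_pmf (?j q) (map_pmf (\<lambda>f. (map cut f, concat (map up f))) (?R k)))"
    by (simp add: map_bind_pmf bind_map_pmf map_pmf_comp map_pmf_def[symmetric])
  also have "\<dots> = bind_pmf W (\<lambda>t. bind_pmf (?R (y t)) (\<lambda>a. bind_pmf (?R k) (\<lambda>f.
      map_pmf (\<lambda>as. (cut t # map cut f, a @ as)) (?R (sum_list (map y f))))))"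
    unfolding assms Suc.IH by (simp add: map_bind_pmf bind_map_pmf bind_assoc_pmf map_pmf_comp)
  \<comment> \<open>The fresh samples above the first tree are independent of the remaining trees, so the
    two draws may be exchanged and the fresh samples collected at the end.\<close>
  also have "\<dots> = bind_pmf W (\<lambda>t. bind_pmf (?R k) (\<lambda>f. bind_pmf (?R (y t)) (\<lambda>a.
      map_pmf (\<lambda>as. (cut t # map cut f, a @ as)) (?R (sum_list (map y f))))))"
    by (subst bind_commute_pmf) simp
  also have "\<dots> = bind_pmf W (\<lambda>t. bind_pmf (?R k) (\<lambda>f.
      map_pmf (Pair (cut t # map cut f)) (?R (y t + sum_list (map y f)))))"
    by (simp add: replicate_pmf_distrib map_bind_pmf map_pmf_def bind_assoc_pmf bind_return_pmf)
  also have "\<dots> = bind_pmf (?R (Suc k)) (\<lambda>f.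
      map_pmf (Pair (map cut f)) (?R (sum_list (map y f))))"
    by (simp add: bind_assoc_pmf bind_return_pmf)
  finally show ?case .
qed

lemma nn_integral_replicate_pmf_sum_list:
  "(\<integral>\<^sup>+ f. of_nat (sum_list (map y f)) \<partial>replicate_pmf k W) = of_nat k * (\<integral>\<^sup>+ t. of_nat (y t) \<partial>measure_pmf W :: ennreal)"
proof (induction k)
  case (Suc k)
  have "(\<integral>\<^sup>+ f. of_nat (sum_list (map y f)) \<partial>replicate_pmf (Suc k) W) =
      (\<integral>\<^sup>+ t. (\<integral>\<^sup>+ f. of_nat (y t) + of_nat (sum_list (map y f)) \<partial>replicate_pmf k W) \<partial>W :: ennreal)"
    by simp
  also have "\<dots> = (\<integral>\<^sup>+ t. of_nat (y t) + of_nat k * (\<integral>\<^sup>+ t. of_nat (y t) \<partial>W) \<partial>W)"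
    by (subst nn_integral_add) (simp_all add: Suc.IH)
  also have "\<dots> = of_nat (Suc k) * (\<integral>\<^sup>+ t. of_nat (y t) \<partial>measure_pmf W)"
    by (subst nn_integral_add) (simp_all add: algebra_simps)
  finally show ?case .
qed simp

lemma measure_replicate_pmf_append:
  "measure_pmf.prob (replicate_pmf (m + l) W) {h. take m h \<in> B \<and> drop m h \<in> C} =
    measure_pmf.prob (replicate_pmf m W) B * measure_pmf.prob (replicate_pmf l W) C"
proof -
  have "emeasure (replicate_pmf (m + l) W) {h. take m h \<in> B \<and> drop m h \<in> C} =
      (\<integral>\<^sup>+ f. (\<integral>\<^sup>+ g. indicator {h. take m h \<in> B \<and> drop m h \<in> C} (f @ g)
        \<partial>replicate_pmf l W) \<partial>replicate_pmf m W)"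
    by (simp add: replicate_pmf_distrib)
  also have "\<dots> = (\<integral>\<^sup>+ f. (\<integral>\<^sup>+ g. indicator B f * indicator C g \<partial>replicate_pmf l W) \<partial>replicate_pmf m W)"
    by (intro nn_integral_cong_AE AE_pmfI)
       (auto simp: set_replicate_pmf indicator_def intro!: nn_integral_cong)
  also have "\<dots> = emeasure (replicate_pmf m W) B * emeasure (replicate_pmf l W) C"
    by (simp add: nn_integral_cmult nn_integral_multc)
  finally show ?thesis
    by (simp add: measure_pmf.emeasure_eq_measure ennreal_mult[symmetric])
qed

lemma measure_replicate_pmf_subset:
  "measure_pmf.prob (replicate_pmf k W) {f. set f \<subseteq> C} = measure_pmf.prob W C ^ k"
proof (induction k)
  case (Suc k)
  have "emeasure (replicate_pmf (Suc k) W) {f. set f \<subseteq> C} =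
      (\<integral>\<^sup>+ t. (\<integral>\<^sup>+ f. indicator {f. set f \<subseteq> C} (t # f) \<partial>replicate_pmf k W) \<partial>W)"
    by simp
  also have "\<dots> = (\<integral>\<^sup>+ t. (\<integral>\<^sup>+ f. indicator C t * indicator {f. set f \<subseteq> C} f \<partial>replicate_pmf k W) \<partial>W)"
    by (intro nn_integral_cong) (auto simp: indicator_def)
  also have "\<dots> = emeasure W C * emeasure (replicate_pmf k W) {f. set f \<subseteq> C}"
    by (simp add: nn_integral_cmult nn_integral_multc)
  finally show ?case
    by (simp add: measure_pmf.emeasure_eq_measure ennreal_mult[symmetric] Suc.IH)
qed simp

lemma measure_replicate_pmf_ex:
  "measure_pmf.prob (replicate_pmf k W) {f. \<exists>t\<in>set f. t \<in> B} = 1 - (1 - measure_pmf.prob W B) ^ k"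
proof -
  have "measure_pmf.prob (replicate_pmf k W) {f. \<exists>t\<in>set f. t \<in> B} =
      1 - measure_pmf.prob (replicate_pmf k W) (- {f. \<exists>t\<in>set f. t \<in> B})"
    using measure_pmf.prob_compl[of "- {f. \<exists>t\<in>set f. t \<in> B}" "replicate_pmf k W"]
    by (simp add: Compl_eq_Diff_UNIV[symmetric])
  moreover have "- {f. \<exists>t\<in>set f. t \<in> B} = {f. set f \<subseteq> - B}"
    by auto
  moreover have "measure_pmf.prob W (- B) = 1 - measure_pmf.prob W B"
    using measure_pmf.prob_compl[of B W] by (simp add: Compl_eq_Diff_UNIV)
  ultimately show ?thesis
    by (simp add: measure_replicate_pmf_subset)
qed

lemma ex_offspring_ge_2:
  assumes mean: "(\<integral>\<^sup>+ k. of_nat k \<partial>measure_pmf p) = (1 :: ennreal)" and p_1: "pmf p 1 \<noteq> 1"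
  shows "\<exists>j\<ge>2. j \<in> set_pmf p"
proof (rule ccontr)
  assume "\<not> (\<exists>j\<ge>2. j \<in> set_pmf p)"
  then have le: "j = 0 \<or> j = 1" if "j \<in> set_pmf p" for j
    using that by (cases "j \<ge> 2") auto
  have "(\<integral>\<^sup>+ k. of_nat k \<partial>measure_pmf p) = (\<integral>\<^sup>+ k. indicator {1} k \<partial>measure_pmf p :: ennreal)"
    using le by (intro nn_integral_cong_AE AE_pmfI) fastforce
  then have "pmf p 1 = 1"
    using mean by (simp add: emeasure_pmf_single)
  with p_1 show False ..
qed

text \<open>A law \<open>W\<close> on finite trees that solves the Galton-Watson recursion: draw the number of
  children from \<open>p\<close>, of mean 1, and plant that many independent samples of \<open>W\<close>.\<close>
locale finite_tree_law =
  fixes p :: "nat pmf" and W :: "tree pmf"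
  assumes W_finite: "set_pmf W \<subseteq> finite_trees"
    and W_eq: "W = bind_pmf p (\<lambda>k. map_pmf plant (replicate_pmf k W))"
    and mean_1: "(\<integral>\<^sup>+ k. of_nat k \<partial>measure_pmf p) = (1 :: ennreal)"
begin

lemma set_replicate_finite: "f \<in> set_pmf (replicate_pmf k W) \<Longrightarrow> set f \<subseteq> finite_trees"
  using W_finite by (auto simp: set_replicate_pmf)

lemma Y_at_plant:
  assumes "set f \<subseteq> finite_trees"
  shows "Y_at (Suc b) (plant f) = sum_list (map (Y_at b) f)"
  using above_plant[OF assms, of b] length_above[of "Suc b" "plant f"]
  by (simp add: length_concat o_def length_above)

text \<open>The branching property. The right-hand side draws \<open>t\<close> only to keep its truncation and its
  number of nodes at height \<open>b\<close>, and replaces the forest above by fresh independent samples.\<close>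
lemma branching:
  "map_pmf (\<lambda>t. (truncate b t, above b t)) W =
    bind_pmf W (\<lambda>t. map_pmf (Pair (truncate b t)) (replicate_pmf (Y_at b t) W))"
proof (induction b)
  case 0
  have eq: "truncate 0 t = {[]}" "above 0 t = [t]" "Y_at 0 t = 1" if "t \<in> set_pmf W" for t
    using truncate_0 above_0 length_above[of 0 t] that W_finite finite_trees_subset by auto
  have "map_pmf (\<lambda>t. (truncate 0 t, above 0 t)) W = map_pmf (\<lambda>t. ({[]}, [t])) W"
    using eq by (intro map_pmf_cong) auto
  also have "\<dots> = bind_pmf W (\<lambda>t. map_pmf (Pair {[]}) (replicate_pmf 1 W))"
    unfolding replicate_pmf_1 by (simp add: map_pmf_comp)
  also have "\<dots> = bind_pmf W (\<lambda>t. map_pmf (Pair (truncate 0 t)) (replicate_pmf (Y_at 0 t) W))"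
    using eq by (intro bind_pmf_cong) (auto simp del: bind_pmf_const)
  finally show ?case .
next
  case (Suc b)
  let ?R = "\<lambda>n. replicate_pmf n W"
  have "map_pmf (\<lambda>t. (truncate (Suc b) t, above (Suc b) t)) W =
    bind_pmf p (\<lambda>k. map_pmf (\<lambda>f. (truncate (Suc b) (plant f), above (Suc b) (plant f))) (?R k))"
    by (subst W_eq) (simp add: map_bind_pmf map_pmf_comp)
  also have "\<dots> = bind_pmf p (\<lambda>k. map_pmf (apfst plant)
      (map_pmf (\<lambda>f. (map (truncate b) f, concat (map (above b) f))) (?R k)))"
    unfolding map_pmf_comp using set_replicate_finite
    by (intro bind_pmf_cong map_pmf_cong) (auto simp: truncate_plant above_plant)
  also have "\<dots> = bind_pmf p (\<lambda>k. bind_pmf (?R k) (\<lambda>f.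
      map_pmf (Pair (plant (map (truncate b) f))) (?R (sum_list (map (Y_at b) f)))))"
    unfolding map_pmf_replicate_pmf_concat[OF Suc.IH] by (simp add: map_bind_pmf map_pmf_comp)
  also have "\<dots> = bind_pmf p (\<lambda>k. bind_pmf (?R k) (\<lambda>f.
      map_pmf (Pair (truncate (Suc b) (plant f))) (?R (Y_at (Suc b) (plant f)))))"
    using set_replicate_finite
    by (intro bind_pmf_cong) (auto simp: truncate_plant Y_at_plant)
  also have "\<dots> = bind_pmf W (\<lambda>t.
      map_pmf (Pair (truncate (Suc b) t)) (replicate_pmf (Y_at (Suc b) t) W))"
    by (subst (3) W_eq) (simp add: bind_assoc_pmf bind_map_pmf)
  finally show ?case .
qed

lemma mean_Y_at: "(\<integral>\<^sup>+ t. of_nat (Y_at b t) \<partial>measure_pmf W) = (1 :: ennreal)"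
proof (induction b)
  case 0
  have "(\<integral>\<^sup>+ t. of_nat (Y_at 0 t) \<partial>measure_pmf W) = (\<integral>\<^sup>+ t. 1 \<partial>measure_pmf W :: ennreal)"
  proof (intro nn_integral_cong_AE AE_pmfI)
    fix t assume "t \<in> set_pmf W"
    then have "above 0 t = [t]"
      using above_0 W_finite finite_trees_subset by blast
    then show "(of_nat (Y_at 0 t) :: ennreal) = 1"
      using length_above[of 0 t] by simp
  qed
  then show ?case
    by simp
next
  case (Suc b)
  have "(\<integral>\<^sup>+ t. of_nat (Y_at (Suc b) t) \<partial>measure_pmf W) =
      (\<integral>\<^sup>+ k. (\<integral>\<^sup>+ f. of_nat (Y_at (Suc b) (plant f)) \<partial>replicate_pmf k W) \<partial>p :: ennreal)"
    by (subst W_eq) simp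
  also have "\<dots> = (\<integral>\<^sup>+ k. (\<integral>\<^sup>+ f. of_nat (sum_list (map (Y_at b) f)) \<partial>replicate_pmf k W) \<partial>p)"
    using set_replicate_finite
    by (intro nn_integral_cong_AE AE_pmfI) (auto simp: Y_at_plant)
  also have "\<dots> = 1"
    by (simp only: nn_integral_replicate_pmf_sum_list Suc.IH mult_1_right mean_1)
  finally show ?case .
qed

lemma prob_branching:
  "measure_pmf.prob W {t. Q (truncate b t) (above b t)} =
    measure_pmf.expectation W
      (\<lambda>t. measure_pmf.prob (replicate_pmf (Y_at b t) W) {f. Q (truncate b t) f})"
proof -
  have "emeasure W {t. Q (truncate b t) (above b t)} =
      emeasure (map_pmf (\<lambda>t. (truncate b t, above b t)) W) {x. Q (fst x) (snd x)}"
    by (simp add: vimage_def)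
  also have "\<dots> = (\<integral>\<^sup>+ t. emeasure (replicate_pmf (Y_at b t) W) {f. Q (truncate b t) f} \<partial>W)"
    unfolding branching by (simp add: vimage_def)
  also have "\<dots> = (\<integral>\<^sup>+ t. ennreal (measure_pmf.prob (replicate_pmf (Y_at b t) W) {f. Q (truncate b t) f}) \<partial>W)"
    by (simp only: measure_pmf.emeasure_eq_measure)
  finally have "measure_pmf.prob W {t. Q (truncate b t) (above b t)} =
      enn2real (\<integral>\<^sup>+ t. ennreal (measure_pmf.prob (replicate_pmf (Y_at b t) W) {f. Q (truncate b t) f}) \<partial>W)"
    by (simp only: measure_def[of "measure_pmf W"])
  also have "\<dots> = measure_pmf.expectation W
      (\<lambda>t. measure_pmf.prob (replicate_pmf (Y_at b t) W) {f. Q (truncate b t) f})"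
    by (rule integral_eq_nn_integral[symmetric]) auto
  finally show ?thesis .
qed

end

section \<open>Tail ratios for a monotone functional\<close>

text \<open>The setting of both limits, expressed through the law of a single tree.\<close>
locale monotone_tree_functional = finite_tree_law +
  fixes A :: "forest \<Rightarrow> nat"
  assumes A_mono: "monotone_functional A"
    and tail_pos: "0 < measure_pmf.prob W {t. n < A [t]}"
    and p_1: "pmf p 1 \<noteq> 1"
begin

text \<open>Tail of \<open>A\<close> on a single random tree.\<close>
definition tree_tail :: "nat \<Rightarrow> real" where
  "tree_tail n = measure_pmf.prob W {t. n < A [t]}"

text \<open>Tail of \<open>A\<close> on a forest of \<open>k\<close> independent trees.\<close>
definition forest_tail :: "nat \<Rightarrow> nat \<Rightarrow> real" where
  "forest_tail k n = measure_pmf.prob (replicate_pmf k W) {f. n < A f}"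

text \<open>Tail of the largest value of \<open>A\<close> on the single trees of a forest of \<open>k\<close> independent trees.\<close>
definition max_tail :: "nat \<Rightarrow> nat \<Rightarrow> real" where
  "max_tail k n = measure_pmf.prob (replicate_pmf k W) {f. \<exists>t\<in>set f. n < A [t]}"

text \<open>No restriction on the size of \<open>f\<close> is needed: \<open>f\<close> is the forest above height 1 of
  \<open>plant f\<close>.\<close>
lemma A_le_A_forest:
  assumes "set f \<subseteq> finite_trees" "t \<in> set f"
  shows "A [t] \<le> A f"
proof -
  obtain i where i: "i < length f" "t = f ! i"
    using assms(2) by (auto simp: in_set_conv_nth)
  have "Y_at 1 (plant f) = length f"
    using length_above[of 1 "plant f"] above_1_plant[OF assms(1)] by simp
  then have "Suc i \<in> {1..Y_at 1 (plant f)}"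
    using i(1) by simp
  then have "A [above 1 (plant f) ! (Suc i - 1)] \<le> A (above 1 (plant f))"
    using A_mono plant_in_finite_trees[OF assms(1)] unfolding monotone_functional_def by blast
  then show ?thesis
    using i above_1_plant[OF assms(1)] by simp
qed

text \<open>The hypothesis \<open>Y_at b t \<ge> 1\<close> is needed because \<open>monotone_functional\<close> says nothing
  about a tree without nodes at height \<open>b\<close>.\<close>
lemma A_above_le:
  assumes "t \<in> finite_trees" "b \<ge> 1" "Y_at b t \<ge> 1"
  shows "A (above b t) \<le> A [t]"
proof -
  have "1 \<in> {1..Y_at b t}"
    using assms(3) by simp
  then show ?thesis
    using A_mono assms(1,2) unfolding monotone_functional_def by blast
qed

lemma tree_tail_pos: "0 < tree_tail n"
  using tail_pos by (simp add: tree_tail_def)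

lemma tree_tail_le_1: "tree_tail n \<le> 1"
  by (simp add: tree_tail_def)

lemma tree_tail_antimono: "n \<le> n' \<Longrightarrow> tree_tail n' \<le> tree_tail n"
  unfolding tree_tail_def by (intro measure_pmf.finite_measure_mono) auto

lemma tree_tail_tendsto_0: "tree_tail \<longlonglongrightarrow> 0"
proof -
  have "(\<lambda>n. measure_pmf.prob W {t. n < A [t]}) \<longlonglongrightarrow> measure_pmf.prob W (\<Inter>n. {t. n < A [t]})"
    by (rule measure_pmf.finite_Lim_measure_decseq) (auto simp: decseq_def)
  moreover have "(\<Inter>n. {t. n < A [t]}) = {}"
    by auto
  ultimately show ?thesis
    by (simp add: tree_tail_def[abs_def])
qed

lemma max_tail_eq: "max_tail k n = 1 - (1 - tree_tail n) ^ k"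
  using measure_replicate_pmf_ex[of k W "{t. n < A [t]}"]
  by (simp add: max_tail_def tree_tail_def)

lemma max_tail_le_forest_tail: "max_tail k n \<le> forest_tail k n"
  unfolding max_tail_def forest_tail_def
proof (intro measure_pmf.finite_measure_mono_AE AE_pmfI impI)
  fix f assume "f \<in> set_pmf (replicate_pmf k W)" "f \<in> {f. \<exists>t\<in>set f. n < A [t]}"
  then show "f \<in> {f. n < A f}"
    using A_le_A_forest set_replicate_finite by (fastforce intro: less_le_trans)
qed simp

text \<open>The ratio is a polynomial in the tail, which gives the bound by \<open>k\<close> as well as the
  limit \<open>k\<close>.\<close>
lemma max_tail_ratio: "max_tail k n / tree_tail n = (\<Sum>i<k. (1 - tree_tail n) ^ i)"
  using tree_tail_pos[of n] one_diff_power_eq[of "1 - tree_tail n" k]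
  by (simp add: max_tail_eq)

lemma max_tail_ratio_nonneg: "0 \<le> max_tail k n / tree_tail n"
  using tree_tail_pos[of n] by (simp add: max_tail_def)

lemma max_tail_ratio_le: "max_tail k n / tree_tail n \<le> real k"
proof -
  have "(\<Sum>i<k. (1 - tree_tail n) ^ i) \<le> (\<Sum>i<k. 1)"
    using tree_tail_pos[of n] tree_tail_le_1[of n] by (intro sum_mono power_le_one) auto
  then show ?thesis
    by (simp add: max_tail_ratio)
qed

lemma max_tail_ratio_tendsto: "(\<lambda>n. max_tail k n / tree_tail n) \<longlonglongrightarrow> real k"
proof -
  have "(\<lambda>n. \<Sum>i<k. (1 - tree_tail n) ^ i) \<longlonglongrightarrow> (\<Sum>i<k. (1 - 0) ^ i)"
    by (intro tendsto_intros tree_tail_tendsto_0)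
  then show ?thesis
    by (simp add: max_tail_ratio)
qed

lemma integrable_Y_at: "integrable (measure_pmf W) (\<lambda>t. real (Y_at b t))"
  using mean_Y_at[of b]
  by (intro integrableI_bounded) (simp_all add: ennreal_of_nat_eq_real_of_nat)

lemma expectation_Y_at: "measure_pmf.expectation W (\<lambda>t. real (Y_at b t)) = 1"
  using mean_Y_at[of b]
  by (subst integral_eq_nn_integral) (simp_all add: ennreal_of_nat_eq_real_of_nat)

text \<open>The upper bound behind both limits. The sequence \<open>U\<close> depends on \<open>b\<close> and \<open>S\<close> only, while the
  event \<open>Z\<close> for the \<open>m\<close> trees above height \<open>b\<close> may vary with \<open>n\<close>.\<close>
lemma generation_bound:
  assumes b: "b \<ge> 1"
    and S: "\<And>t. truncate b t \<in> S \<Longrightarrow> Y_at b t = m"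
    and pos: "0 < measure_pmf.prob W {t. truncate b t \<in> S}"
  obtains U where "U \<longlonglongrightarrow> real m"
    and "\<And>n Z. (\<And>t. t \<in> finite_trees \<Longrightarrow> truncate b t \<in> S \<Longrightarrow> above b t \<in> Z \<Longrightarrow> n < A [t])
      \<Longrightarrow> measure_pmf.prob (replicate_pmf m W) Z / tree_tail n \<le> U n"
proof -
  let ?P = "measure_pmf.prob W {t. truncate b t \<in> S}"
  let ?I = "\<lambda>t. indicator {t. truncate b t \<notin> S} t :: real"
  let ?J = "\<lambda>t. indicator {t. truncate b t \<in> S} t :: real"
  define E where "E n = measure_pmf.expectation W (\<lambda>t. ?I t * (max_tail (Y_at b t) n / tree_tail n))" for n
  have int_J: "integrable (measure_pmf W) (\<lambda>t. ?J t * c)" for c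
    by (intro measure_pmf.integrable_const_bound[where B = "\<bar>c\<bar>"]) (auto simp: indicator_def)
  have bd: "norm (?I t * (max_tail (Y_at b t) n / tree_tail n)) \<le> real (Y_at b t)" for t n
    using max_tail_ratio_le[of "Y_at b t" n] abs_of_nonneg[OF max_tail_ratio_nonneg[of "Y_at b t" n]]
    by (simp add: indicator_def del: abs_divide)
  have "integrable (measure_pmf W) (\<lambda>t. ?I t * (max_tail (Y_at b t) n / tree_tail n))" for n
  proof (rule Bochner_Integration.integrable_bound[OF integrable_Y_at[of b]])
    show "AE t in measure_pmf W. norm (?I t * (max_tail (Y_at b t) n / tree_tail n)) \<le> norm (real (Y_at b t))"
      using bd by simp
  qed simp
  note int_I = this
  \<comment> \<open>The integrand is dominated by \<open>Y_at b\<close>, which has mean 1.\<close>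
  have lim_E: "E \<longlonglongrightarrow> measure_pmf.expectation W (\<lambda>t. ?I t * real (Y_at b t))"
    unfolding E_def
  proof (rule integral_dominated_convergence[where w = "\<lambda>t. real (Y_at b t)"])
    show "AE t in measure_pmf W. (\<lambda>n. ?I t * (max_tail (Y_at b t) n / tree_tail n)) \<longlonglongrightarrow> ?I t * real (Y_at b t)"
      by (intro AE_I2 tendsto_intros max_tail_ratio_tendsto)
    show "AE t in measure_pmf W. norm (?I t * (max_tail (Y_at b t) n / tree_tail n)) \<le> real (Y_at b t)" for n
      using bd by simp
  qed (auto intro: integrable_Y_at)
  have "measure_pmf.expectation W (\<lambda>t. ?I t * real (Y_at b t)) =
      measure_pmf.expectation W (\<lambda>t. real (Y_at b t) - ?J t * real m)"
    using S by (intro Bochner_Integration.integral_cong) (auto simp: indicator_def)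
  also have "\<dots> = 1 - ?P * real m"
    by (subst Bochner_Integration.integral_diff[OF integrable_Y_at int_J]) (simp add: expectation_Y_at)
  finally have lim_E': "E \<longlonglongrightarrow> 1 - ?P * real m"
    using lim_E by simp
  have "(\<lambda>n. (1 - E n) / ?P) \<longlonglongrightarrow> (1 - (1 - ?P * real m)) / ?P"
    using pos by (intro tendsto_intros lim_E') simp
  then have lim_U: "(\<lambda>n. (1 - E n) / ?P) \<longlonglongrightarrow> real m"
    using pos by simp
  have "measure_pmf.prob (replicate_pmf m W) Z / tree_tail n \<le> (1 - E n) / ?P"
    if Z: "\<And>t. t \<in> finite_trees \<Longrightarrow> truncate b t \<in> S \<Longrightarrow> above b t \<in> Z \<Longrightarrow> n < A [t]" for n Z
  proof -
    \<comment> \<open>A sufficient condition for \<open>n < A [t]\<close> in terms of truncation and forest above.\<close>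
    define Q where "Q s f \<longleftrightarrow> (if s \<in> S then f \<in> Z else \<exists>x\<in>set f. n < A [x])" for s f
    let ?z = "measure_pmf.prob (replicate_pmf m W) Z"
    have "measure_pmf.expectation W
        (\<lambda>t. measure_pmf.prob (replicate_pmf (Y_at b t) W) {f. Q (truncate b t) f}) =
      measure_pmf.expectation W
        (\<lambda>t. ?J t * ?z + tree_tail n * (?I t * (max_tail (Y_at b t) n / tree_tail n)))"
      using S tree_tail_pos[of n]
      by (intro Bochner_Integration.integral_cong) (auto simp: indicator_def Q_def max_tail_def)
    also have "\<dots> = ?P * ?z + tree_tail n * E n"
      by (subst Bochner_Integration.integral_add[OF int_J integrable_mult_right[OF int_I]])
         (simp add: E_def)
    finally have "?P * ?z + tree_tail n * E n = measure_pmf.prob W {t. Q (truncate b t) (above b t)}"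
      by (simp add: prob_branching)
    also have "\<dots> \<le> tree_tail n"
      unfolding tree_tail_def
    proof (intro measure_pmf.finite_measure_mono_AE AE_pmfI impI)
      fix t assume t: "t \<in> set_pmf W" "t \<in> {t. Q (truncate b t) (above b t)}"
      then have fin: "t \<in> finite_trees"
        using W_finite by blast
      show "t \<in> {t. n < A [t]}"
      proof (cases "truncate b t \<in> S")
        case True
        then show ?thesis
          using t(2) Z[OF fin] by (simp add: Q_def)
      next
        case False
        then obtain x where x: "x \<in> set (above b t)" "n < A [x]"
          using t(2) by (auto simp: Q_def)
        then obtain i where i: "i < Y_at b t" "x = above b t ! i"
          using length_above by (metis in_set_conv_nth)
        then have "Suc i \<in> {1..Y_at b t}"
          by simp
        then have "A [above b t ! (Suc i - 1)] \<le> A [t]"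
          using A_mono fin b unfolding monotone_functional_def by (meson order_trans)
        then show ?thesis
          using x i by simp
      qed
    qed simp
    finally have "?P * ?z \<le> tree_tail n * (1 - E n)"
      by (simp add: algebra_simps)
    then show ?thesis
      using pos tree_tail_pos[of n] by (simp add: field_simps)
  qed
  with lim_U show thesis
    using that by blast
qed

lemma forest_tail_ratio_generation:
  assumes "k \<ge> 1" "b \<ge> 1" "0 < measure_pmf.prob W {t. Y_at b t = k}"
  shows "(\<lambda>n. forest_tail k n / tree_tail n) \<longlonglongrightarrow> real k"
proof -
  have "0 < measure_pmf.prob W {t. truncate b t \<in> {s. Y_at b s = k}}"
    using assms(3) by (simp add: Y_at_truncate)
  moreover have "Y_at b t = k" if "truncate b t \<in> {s. Y_at b s = k}" for t
    using that by (simp add: Y_at_truncate)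
  ultimately obtain U where U: "U \<longlonglongrightarrow> real k"
      "\<And>n Z. (\<And>t. t \<in> finite_trees \<Longrightarrow> truncate b t \<in> {s. Y_at b s = k} \<Longrightarrow> above b t \<in> Z \<Longrightarrow> n < A [t])
        \<Longrightarrow> measure_pmf.prob (replicate_pmf k W) Z / tree_tail n \<le> U n"
    using generation_bound[of b "{s. Y_at b s = k}" k] assms(2) by blast
  have up: "forest_tail k n / tree_tail n \<le> U n" for n
    unfolding forest_tail_def
  proof (rule U(2))
    fix t assume t: "t \<in> finite_trees" "truncate b t \<in> {s. Y_at b s = k}" "above b t \<in> {f. n < A f}"
    then show "n < A [t]"
      using A_above_le[of t b] assms(1,2) by (simp add: Y_at_truncate)
  qed
  show ?thesis
  proof (rule tendsto_sandwich[OF _ _ max_tail_ratio_tendsto U(1)])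
    show "eventually (\<lambda>n. max_tail k n / tree_tail n \<le> forest_tail k n / tree_tail n) sequentially"
      using max_tail_le_forest_tail tree_tail_pos by (intro always_eventually allI divide_right_mono) (auto simp: less_imp_le)
  qed (use up in simp)
qed

text \<open>If \<open>j \<ge> 2\<close> children have positive probability, so does a generation \<open>b\<close> of size at
  least \<open>2 ^ b\<close>.\<close>
lemma ex_large_generation:
  obtains m b where "k \<le> m" "b \<ge> 1" "0 < measure_pmf.prob W {t. Y_at b t = m}"
proof -
  obtain j where j: "j \<ge> 2" "j \<in> set_pmf p"
    using ex_offspring_ge_2[OF mean_1 p_1] by blast
  have ex: "\<exists>t\<in>set_pmf W. 2 ^ b \<le> Y_at b t" for b
  proof (induction b)
    case 0
    obtain t where t: "t \<in> set_pmf W"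
      using set_pmf_not_empty[of W] by blast
    then have "Y_at 0 t = 1"
      using above_0[of t] length_above[of 0 t] W_finite finite_trees_subset by auto
    with t show ?case
      by force
  next
    case (Suc b)
    then obtain t where t: "t \<in> set_pmf W" "2 ^ b \<le> Y_at b t"
      by blast
    let ?f = "replicate j t"
    have f: "?f \<in> set_pmf (replicate_pmf j W)"
      using t by (auto simp: set_replicate_pmf)
    then have "plant ?f \<in> set_pmf W"
      using j by (subst W_eq) auto
    moreover have "Y_at (Suc b) (plant ?f) = j * Y_at b t"
      using Y_at_plant[OF set_replicate_finite[OF f]] by (simp add: sum_list_replicate)
    moreover have "2 * 2 ^ b \<le> j * Y_at b t"
      using j(1) t(2) by (rule mult_le_mono)
    ultimately show ?case
      by (intro bexI[of _ "plant ?f"]) simp_all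
  qed
  obtain t where t: "t \<in> set_pmf W" "2 ^ Suc k \<le> Y_at (Suc k) t"
    using ex by blast
  have "k < 2 ^ Suc k"
    by (metis less_exp Suc_lessD)
  then have "k \<le> Y_at (Suc k) t"
    using t(2) by simp
  moreover have "0 < measure_pmf.prob W {t'. Y_at (Suc k) t' = Y_at (Suc k) t}"
    using t(1) by (intro measure_pmf_posI[of t]) auto
  ultimately show thesis
    using that[of "Y_at (Suc k) t" "Suc k"] by simp
qed

lemma forest_tail_ratio_extendable:
  assumes k: "k \<ge> 1"
    and ext: "\<And>f g. set f \<subseteq> finite_trees \<Longrightarrow> set g \<subseteq> finite_trees \<Longrightarrow> f \<noteq> [] \<Longrightarrow> A f \<le> A (f @ g)"
  shows "(\<lambda>n. forest_tail k n / tree_tail n) \<longlonglongrightarrow> real k"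
proof -
  obtain m b where m: "k \<le> m" "b \<ge> 1" "0 < measure_pmf.prob W {t. Y_at b t = m}"
    using ex_large_generation by blast
  then obtain l where l: "m = k + l"
    using le_Suc_ex by blast
  have lim_m: "(\<lambda>n. forest_tail m n / tree_tail n) \<longlonglongrightarrow> real m"
    using m k by (intro forest_tail_ratio_generation) auto
  \<comment> \<open>If \<open>A\<close> does not exceed \<open>n\<close> on \<open>k + l\<close> trees, it does not exceed \<open>n\<close> on the first \<open>k\<close> of
    them, nor on any single one of the other \<open>l\<close>; these two events are independent.\<close>
  have bound: "forest_tail k n * (1 - max_tail l n) \<le> forest_tail m n - max_tail l n" for n
  proof -
    have "1 - forest_tail m n = measure_pmf.prob (replicate_pmf m W) {h. \<not> n < A h}"
      using measure_pmf.prob_neg[of "replicate_pmf m W" "\<lambda>h. n < A h"] by (simp add: forest_tail_def)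
    also have "\<dots> \<le> measure_pmf.prob (replicate_pmf m W)
        {h. take k h \<in> {f. \<not> n < A f} \<and> drop k h \<in> {g. set g \<subseteq> {t. \<not> n < A [t]}}}"
    proof (intro measure_pmf.finite_measure_mono_AE AE_pmfI impI)
      fix h assume h: "h \<in> set_pmf (replicate_pmf m W)" "h \<in> {h. \<not> n < A h}"
      have fin: "set h \<subseteq> finite_trees"
        using h(1) by (rule set_replicate_finite)
      have "take k h \<noteq> []"
        using h(1) k l by (auto simp: set_replicate_pmf)
      moreover have "set (take k h) \<subseteq> finite_trees" "set (drop k h) \<subseteq> finite_trees"
        using fin set_take_subset[of k h] set_drop_subset[of k h] by blast+
      ultimately have "A (take k h) \<le> A (take k h @ drop k h)"
        by (intro ext)
      moreover have "A [t] \<le> A h" if "t \<in> set (drop k h)" for t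
        using A_le_A_forest[OF fin] that set_drop_subset[of k h] by blast
      ultimately show "h \<in> {h. take k h \<in> {f. \<not> n < A f} \<and> drop k h \<in> {g. set g \<subseteq> {t. \<not> n < A [t]}}}"
        using h(2) by fastforce
    qed simp
    also have "\<dots> = (1 - forest_tail k n) * (1 - max_tail l n)"
    proof -
      have "measure_pmf.prob (replicate_pmf k W) {f. \<not> n < A f} = 1 - forest_tail k n"
        using measure_pmf.prob_neg[of "replicate_pmf k W" "\<lambda>h. n < A h"] by (simp add: forest_tail_def)
      moreover have "measure_pmf.prob W {t. \<not> n < A [t]} = 1 - tree_tail n"
        using measure_pmf.prob_neg[of W "\<lambda>t. n < A [t]"] by (simp add: tree_tail_def)
      ultimately show ?thesis
        unfolding l measure_replicate_pmf_append measure_replicate_pmf_subset max_tail_eq by simp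
    qed
    finally show ?thesis
      by (simp add: algebra_simps)
  qed
  have lim_1: "(\<lambda>n. (1 - tree_tail n) ^ l) \<longlonglongrightarrow> 1"
    using tendsto_power[OF tendsto_diff[OF tendsto_const tree_tail_tendsto_0], of 1 l] by simp
  have "(\<lambda>n. (forest_tail m n / tree_tail n - max_tail l n / tree_tail n) / (1 - tree_tail n) ^ l)
      \<longlonglongrightarrow> (real m - real l) / 1"
    by (intro tendsto_divide tendsto_diff lim_m max_tail_ratio_tendsto lim_1) simp
  then have lim_U: "(\<lambda>n. (forest_tail m n / tree_tail n - max_tail l n / tree_tail n) / (1 - tree_tail n) ^ l)
      \<longlonglongrightarrow> real k"
    by (simp add: l)
  have "eventually (\<lambda>n. 0 < (1 - tree_tail n) ^ l) sequentially"
    using order_tendstoD(1)[OF lim_1, of 0] by simp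
  then have up: "eventually (\<lambda>n. forest_tail k n / tree_tail n \<le>
      (forest_tail m n / tree_tail n - max_tail l n / tree_tail n) / (1 - tree_tail n) ^ l) sequentially"
  proof eventually_elim
    case (elim n)
    have "forest_tail k n / tree_tail n * (1 - tree_tail n) ^ l \<le>
        forest_tail m n / tree_tail n - max_tail l n / tree_tail n"
      using divide_right_mono[OF bound[of n], of "tree_tail n"] tree_tail_pos[of n]
      by (simp add: max_tail_eq diff_divide_distrib)
    with elim show ?case
      by (simp add: pos_le_divide_eq)
  qed
  show ?thesis
  proof (rule tendsto_sandwich[OF _ up max_tail_ratio_tendsto lim_U])
    show "eventually (\<lambda>n. max_tail k n / tree_tail n \<le> forest_tail k n / tree_tail n) sequentially"
      using max_tail_le_forest_tail tree_tail_pos by (intro always_eventually allI divide_right_mono) (auto simp: less_imp_le)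
  qed
qed

lemma forest_tail_1: "forest_tail 1 n = tree_tail n"
  unfolding forest_tail_def replicate_pmf_1 by (simp add: tree_tail_def)

text \<open>For large \<open>n\<close> and a tree with truncation \<open>s\<close>, a value of \<open>A\<close> larger than \<open>n - r\<close> on the forest already gives a
  value larger than \<open>n\<close> on the tree. With \<open>m = Y_at b s\<close>, \<open>generation_bound\<close> therefore bounds
  \<open>forest_tail m (n - r)\<close> by about \<open>m * tree_tail n\<close>, while it is at least \<open>max_tail m (n - r)\<close>,
  which is asymptotic to \<open>m * tree_tail (n - r)\<close>.\<close>
lemma tree_tail_shift_by_increment:
  assumes b: "b \<ge> 1" and Y: "Y_at b s \<ge> 1"
    and pos: "0 < measure_pmf.prob W {t. truncate b t = s}"
    and add: "\<And>t. t \<in> finite_trees \<Longrightarrow> truncate b t = s \<Longrightarrow> n0 \<le> A [t] \<Longrightarrow> A [t] = A (above b t) + r"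
  shows "(\<lambda>n. tree_tail (n - r) / tree_tail n) \<longlonglongrightarrow> 1"
proof -
  let ?m = "Y_at b s"
  have m: "Y_at b t = ?m" if "truncate b t \<in> {s}" for t
    using Y_at_truncate[of b t] that by simp
  obtain U where U: "U \<longlonglongrightarrow> real ?m"
      "\<And>n Z. (\<And>t. t \<in> finite_trees \<Longrightarrow> truncate b t \<in> {s} \<Longrightarrow> above b t \<in> Z \<Longrightarrow> n < A [t])
        \<Longrightarrow> measure_pmf.prob (replicate_pmf ?m W) Z / tree_tail n \<le> U n"
    using generation_bound[OF b m, of "{s}"] pos by auto
  have up: "forest_tail ?m (n - r) / tree_tail n \<le> U n" if n: "n0 + r \<le> n" for n
    unfolding forest_tail_def
  proof (rule U(2))
    fix t assume t: "t \<in> finite_trees" "truncate b t \<in> {s}" "above b t \<in> {f. n - r < A f}"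
    then have "n - r < A (above b t)" "A (above b t) \<le> A [t]"
      using A_above_le[of t b] b Y m[OF t(2)] by auto
    moreover from this have "A [t] = A (above b t) + r"
      using add[OF t(1)] t(2) n by simp
    ultimately show "n < A [t]"
      using n by linarith
  qed
  let ?L = "\<lambda>n. max_tail ?m (n - r) / tree_tail (n - r)"
  have L: "?L \<longlonglongrightarrow> real ?m"
    using filterlim_compose[OF max_tail_ratio_tendsto filterlim_minus_const_nat_at_top] .
  have lim_U: "(\<lambda>n. U n / ?L n) \<longlonglongrightarrow> 1"
    using tendsto_divide[OF U(1) L] Y by simp
  have "eventually (\<lambda>n. 0 < ?L n) sequentially"
    using order_tendstoD(1)[OF L, of 0] Y by simp
  then have le: "eventually (\<lambda>n. tree_tail (n - r) / tree_tail n \<le> U n / ?L n) sequentially"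
    using eventually_ge_at_top[of "n0 + r"]
  proof eventually_elim
    case (elim n)
    have "tree_tail (n - r) / tree_tail n * ?L n = max_tail ?m (n - r) / tree_tail n"
      using tree_tail_pos[of "n - r"] by simp
    also have "\<dots> \<le> forest_tail ?m (n - r) / tree_tail n"
      using max_tail_le_forest_tail tree_tail_pos[of n] by (intro divide_right_mono) auto
    also have "\<dots> \<le> U n"
      using elim(2) by (rule up)
    finally show ?case
      using elim(1) by (simp only: pos_le_divide_eq)
  qed
  have ge: "eventually (\<lambda>n. 1 \<le> tree_tail (n - r) / tree_tail n) sequentially"
    using tree_tail_antimono tree_tail_pos by (intro always_eventually) simp
  show ?thesis
    by (rule tendsto_sandwich[OF ge le tendsto_const lim_U])
qed

text \<open>A shift by \<open>i\<close> is at most a shift by \<open>i * r\<close>, that is, \<open>i\<close> shifts by \<open>r\<close>.\<close>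
lemma tree_tail_shift:
  assumes shift: "(\<lambda>n. tree_tail (n - r) / tree_tail n) \<longlonglongrightarrow> 1" and r: "r \<ge> 1"
  shows "(\<lambda>n. tree_tail (n - i) / tree_tail n) \<longlonglongrightarrow> 1"
proof -
  have mult: "(\<lambda>n. tree_tail (n - i * r) / tree_tail n) \<longlonglongrightarrow> 1" for i
  proof (induction i)
    case 0
    have "tree_tail n \<noteq> 0" for n
      using tree_tail_pos[of n] by simp
    then show ?case
      by simp
  next
    case (Suc i)
    have "(\<lambda>n. tree_tail (n - r - i * r) / tree_tail (n - r)) \<longlonglongrightarrow> 1"
      using filterlim_compose[OF Suc filterlim_minus_const_nat_at_top] .
    from tendsto_mult[OF this shift] tree_tail_pos show ?case
      by (simp add: less_imp_neq[symmetric] algebra_simps)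
  qed
  show ?thesis
  proof (rule tendsto_sandwich[OF _ _ tendsto_const mult])
    show "eventually (\<lambda>n. 1 \<le> tree_tail (n - i) / tree_tail n) sequentially"
      using tree_tail_antimono tree_tail_pos by (intro always_eventually) simp
    have "n - i * r \<le> n - i" for n
      using r by (simp add: diff_le_mono2)
    then show "eventually (\<lambda>n. tree_tail (n - i) / tree_tail n \<le> tree_tail (n - i * r) / tree_tail n) sequentially"
      using tree_tail_pos by (intro always_eventually allI divide_right_mono tree_tail_antimono) (auto simp: less_imp_le)
  qed
qed

lemma forest_tail_shift:
  assumes k: "k \<ge> 1"
    and ratio: "(\<lambda>n. forest_tail k n / tree_tail n) \<longlonglongrightarrow> real k"
    and shift: "(\<lambda>n. tree_tail (n - r) / tree_tail n) \<longlonglongrightarrow> 1"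
  shows "(\<lambda>n. forest_tail k (n - r) / forest_tail k n) \<longlonglongrightarrow> 1"
proof -
  have "(\<lambda>n. forest_tail k (n - r) / tree_tail (n - r)) \<longlonglongrightarrow> real k"
    using filterlim_compose[OF ratio filterlim_minus_const_nat_at_top] .
  then have "(\<lambda>n. forest_tail k (n - r) / tree_tail (n - r) * (tree_tail (n - r) / tree_tail n)
      / (forest_tail k n / tree_tail n)) \<longlonglongrightarrow> real k * 1 / real k"
    using k by (intro tendsto_divide tendsto_mult ratio shift) auto
  moreover have "tree_tail n \<noteq> 0" for n
    using tree_tail_pos[of n] by simp
  ultimately show ?thesis
    using k by simp
qed

end

section \<open>The law of a critical Galton-Watson tree\<close>

lemma space_tree_space: "space tree_space = trees"
  by (simp add: tree_space_def space_measure_of_conv)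

lemma truncate_eq_in_sets:
  assumes "s \<in> trees_upto h"
  shows "{t \<in> trees. truncate h t = s} \<in> sets tree_space"
proof -
  have "{{t \<in> trees. truncate h t = s} |h s. s \<in> trees_upto h} \<subseteq> Pow trees"
    by auto
  with assms show ?thesis
    unfolding tree_space_def by (auto simp: sets_measure_of)
qed

text \<open>A finite tree is determined by its truncation at a height that exceeds the heights of all
  its nodes: a longer node of another tree would have a prefix of exactly that height.\<close>
lemma finite_tree_in_sets:
  assumes "t \<in> finite_trees"
  shows "{t} \<in> sets tree_space"
proof -
  have t: "t \<in> trees" "finite t"
    using assms by (auto simp: finite_trees_def)
  define h where "h = Suc (Max (length ` t))"
  have h: "length u < h" if "u \<in> t" for u
    using t(2) that by (simp add: h_def le_imp_less_Suc)
  have "t' = t" if t': "t' \<in> trees" "truncate h t' = t" for t'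
  proof -
    have "length u \<le> h" if u: "u \<in> t'" for u
    proof (rule ccontr)
      assume long: "\<not> length u \<le> h"
      have "take h u @ drop h u \<in> t'"
        using u by simp
      then have "take h u \<in> t'"
        using t'(1) unfolding trees_def by blast
      then have "take h u \<in> t"
        using t'(2) by (auto simp: truncate_def)
      from h[OF this] long show False
        by simp
    qed
    then show ?thesis
      using t'(2) by (auto simp: truncate_def)
  qed
  moreover have "truncate h t = t"
    using h by (force simp: truncate_def)
  ultimately have "{t} = {t' \<in> trees. truncate h t' = t}"
    using t(1) by auto
  moreover have "t \<in> trees_upto h"
    using t(1) h by (auto simp: trees_upto_def less_imp_le)
  ultimately show ?thesis
    using truncate_eq_in_sets by simp
qed

lemma subset_finite_trees_in_sets:
  assumes "B \<subseteq> finite_trees"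
  shows "B \<in> sets tree_space"
proof (rule sets.countable)
  show "countable B"
    using countable_finite_trees assms by (rule countable_subset[rotated])
qed (use assms finite_tree_in_sets in auto)

lemma plant_Nil: "plant [] = {[]}"
  by (simp add: plant_def)

lemma root_in_finite_trees: "{[]} \<in> finite_trees"
  using plant_in_finite_trees[of "[]"] by (simp add: plant_Nil)

lemma truncate_1_tree:
  assumes "t \<in> trees"
  shows "truncate 1 t = plant (replicate (outdeg t []) {[]})"
proof -
  have "truncate 0 (subtree t [Suc i]) = {[]}" if "i < outdeg t []" for i
    using that root_children[OF assms] by (intro truncate_0 subtree_in_trees[OF assms]) simp
  then have "map (truncate 0) (map (\<lambda>i. subtree t [Suc i]) [0..<outdeg t []]) = replicate (outdeg t []) {[]}"
    by (intro nth_equalityI) auto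
  then show ?thesis
    using truncate_plant[of 0 "map (\<lambda>i. subtree t [Suc i]) [0..<outdeg t []]"]
    by (simp add: tree_eq_plant[OF assms, symmetric])
qed

text \<open>The out-degree of the root is determined by the truncation at height 1, a star.\<close>
lemma outdeg_eq_in_sets: "{t \<in> trees. outdeg t [] = n} \<in> sets tree_space"
proof -
  let ?star = "\<lambda>n. plant (replicate n {[]})"
  have star: "set (replicate n {[]}) \<subseteq> trees" for n
    using root_in_finite_trees finite_trees_subset by auto
  have "truncate 1 t = ?star n \<longleftrightarrow> outdeg t [] = n" if "t \<in> trees" for t
    using truncate_1_tree[OF that] plant_inject[OF star star, of "outdeg t []" n] by auto
  then have "{t \<in> trees. outdeg t [] = n} = {t \<in> trees. truncate 1 t = ?star n}"
    by auto
  moreover have "length u \<le> 1" if "u \<in> ?star n" for u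
    using that by (cases u) (auto simp: Cons_in_plant)
  then have "?star n \<in> trees_upto 1"
    using plant_in_trees[OF star] by (auto simp: trees_upto_def)
  ultimately show ?thesis
    using truncate_eq_in_sets[of "?star n" 1] by (simp only:)
qed

lemma finite_trees_iff_subtrees:
  assumes "t \<in> trees"
  shows "t \<in> finite_trees \<longleftrightarrow> (\<forall>i\<in>{1..outdeg t []}. subtree t [i] \<in> finite_trees)"
proof
  assume "t \<in> finite_trees"
  then obtain f where f: "set f \<subseteq> finite_trees" "t = plant f"
    by (rule finite_tree_cases)
  then have deg: "outdeg t [] = length f"
    using outdeg_plant finite_trees_subset by blast
  show "\<forall>i\<in>{1..outdeg t []}. subtree t [i] \<in> finite_trees"
  proof
    fix i assume "i \<in> {1..outdeg t []}"
    then obtain j where "i = Suc j" "j < length f"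
      using deg by (cases i) auto
    then show "subtree t [i] \<in> finite_trees"
      using f by (auto simp: subtree_plant)
  qed
next
  assume "\<forall>i\<in>{1..outdeg t []}. subtree t [i] \<in> finite_trees"
  then have "set (map (\<lambda>i. subtree t [Suc i]) [0..<outdeg t []]) \<subseteq> finite_trees"
    by auto
  then show "t \<in> finite_trees"
    using plant_in_finite_trees tree_eq_plant[OF assms] by metis
qed

lemma pmf_replicate_pmf:
  "pmf (replicate_pmf k W) f = (if length f = k then \<Prod>t\<leftarrow>f. pmf W t else 0)"
proof (cases "length f = k")
  case True
  have "pmf (replicate_pmf (length f) W) f = (\<Prod>t\<leftarrow>f. pmf W t)"
  proof (induction f)
    case (Cons x f)
    have eq: "replicate_pmf (Suc k) W = map_pmf (case_prod (#)) (pair_pmf W (replicate_pmf k W))" for k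
      by (simp add: pair_pmf_def map_bind_pmf)
    have "inj (case_prod (#) :: 'a \<times> 'a list \<Rightarrow> 'a list)"
      by (auto simp: inj_on_def)
    then have "pmf (map_pmf (case_prod (#)) (pair_pmf W (replicate_pmf (length f) W))) (case_prod (#) (x, f)) =
        pmf (pair_pmf W (replicate_pmf (length f) W)) (x, f)"
      by (rule pmf_map_inj')
    then show ?case
      using Cons by (simp add: eq pmf_pair del: replicate_pmf.simps)
  qed simp
  with True show ?thesis
    by simp
next
  case False
  then show ?thesis
    by (simp add: pmf_eq_0_set_pmf set_replicate_pmf)
qed

text \<open>The equality case of Bernoulli's inequality.\<close>
lemma power_eq_tangent_imp_1:
  fixes q :: real
  assumes q: "0 \<le> q" "q \<le> 1" and j: "j \<ge> 2" and eq: "1 - q ^ j = real j * (1 - q)"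
  shows "q = 1"
proof (rule ccontr)
  assume "q \<noteq> 1"
  with q have "q < 1"
    by simp
  have "(\<Sum>i<j. q ^ i) < (\<Sum>i<j. 1)"
  proof (rule sum_strict_mono_ex1)
    show "\<exists>i\<in>{..<j}. q ^ i < 1"
      using j \<open>q < 1\<close> by (intro bexI[of _ 1]) auto
  qed (use q in \<open>auto intro: power_le_one\<close>)
  then have "(1 - q) * (\<Sum>i<j. q ^ i) < (1 - q) * real j"
    using \<open>q < 1\<close> by simp
  then show False
    using eq one_diff_power_eq[of q j] by (metis mult.commute less_irrefl)
qed

text \<open>A random element \<open>X\<close> that takes the values in a countable set \<open>C\<close> with the probabilities of
  \<open>Q\<close> hits each subset of \<open>C\<close> with the probability given by \<open>Q\<close>.\<close>
lemma (in prob_space) prob_in_countable: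
  assumes "countable C" and "B \<subseteq> C"
    and ev: "\<And>c. c \<in> C \<Longrightarrow> {\<omega>\<in>space M. X \<omega> = c} \<in> events"
    and pr: "\<And>c. c \<in> C \<Longrightarrow> prob {\<omega>\<in>space M. X \<omega> = c} = pmf Q c"
  shows "prob {\<omega>\<in>space M. X \<omega> \<in> B} = measure_pmf.prob Q B"
proof -
  have "countable B"
    using assms(2,1) by (rule countable_subset)
  have "{\<omega>\<in>space M. X \<omega> \<in> B} = (\<Union>c\<in>B. {\<omega>\<in>space M. X \<omega> = c})"
    by auto
  also have "emeasure M \<dots> = (\<integral>\<^sup>+ c. emeasure M {\<omega>\<in>space M. X \<omega> = c} \<partial>count_space B)"
    using ev assms(2) \<open>countable B\<close> by (intro emeasure_UN_countable) (auto simp: disjoint_family_on_def)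
  also have "\<dots> = (\<integral>\<^sup>+ c. ennreal (pmf Q c) \<partial>count_space B)"
    using pr assms(2) by (intro nn_integral_cong) (auto simp: emeasure_eq_measure)
  also have "\<dots> = emeasure Q B"
    by (rule nn_integral_pmf)
  finally show ?thesis
    by (simp add: emeasure_eq_measure measure_pmf.emeasure_eq_measure)
qed

text \<open>A Galton-Watson tree with critical, non-degenerate offspring distribution.\<close>
locale critical_galton_watson = prob_space M for M :: "'a measure" +
  fixes p :: "nat pmf" and \<tau> :: "'a \<Rightarrow> tree"
  assumes gw: "galton_watson p M \<tau>" and crit: "critical p" and p_1: "pmf p 1 \<noteq> 1"
begin

lemma random_tree: "\<tau> \<in> measurable M tree_space"
  using gw by (simp add: galton_watson_def)

lemma tau_in_trees: "\<omega> \<in> space M \<Longrightarrow> \<tau> \<omega> \<in> trees"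
  using measurable_space[OF random_tree] by (simp add: space_tree_space)

lemma tau_event: "B \<in> sets tree_space \<Longrightarrow> {\<omega>\<in>space M. \<tau> \<omega> \<in> B} \<in> events"
  using measurable_sets[OF random_tree, of B] by (simp add: vimage_def Int_def conj_commute)

lemma mean_offspring: "(\<integral>\<^sup>+ k. of_nat k \<partial>measure_pmf p) = (1 :: ennreal)"
  using crit nn_integral_eq_integral[of "measure_pmf p" real]
  by (simp add: critical_def ennreal_of_nat_eq_real_of_nat)

text \<open>The defining conditional independence in product form, now also for \<open>n\<close> of probability 0.\<close>
lemma prob_root_decomposition:
  assumes B: "\<And>i. i \<in> {1..n} \<Longrightarrow> B i \<in> sets tree_space"
  shows "prob {\<omega>\<in>space M. outdeg (\<tau> \<omega>) [] = n \<and> (\<forall>i\<in>{1..n}. subtree (\<tau> \<omega>) [i] \<in> B i)} =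
    pmf p n * (\<Prod>i\<in>{1..n}. prob {\<omega>\<in>space M. \<tau> \<omega> \<in> B i})" (is "prob ?E = _ * ?R")
proof -
  have deg: "prob {\<omega>\<in>space M. outdeg (\<tau> \<omega>) [] = n} = pmf p n"
    using gw by (simp add: galton_watson_def)
  have "{\<omega>\<in>space M. outdeg (\<tau> \<omega>) [] = n} = {\<omega>\<in>space M. \<tau> \<omega> \<in> {t \<in> trees. outdeg t [] = n}}"
    using tau_in_trees by auto
  then have ev: "{\<omega>\<in>space M. outdeg (\<tau> \<omega>) [] = n} \<in> events"
    using tau_event[OF outdeg_eq_in_sets] by simp
  show ?thesis
  proof (cases "pmf p n > 0")
    case True
    then have "cond_prob M (\<lambda>\<omega>. \<forall>i\<in>{1..n}. subtree (\<tau> \<omega>) [i] \<in> B i) (\<lambda>\<omega>. outdeg (\<tau> \<omega>) [] = n) = ?R"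
      using gw B unfolding galton_watson_def by blast
    then have "prob {\<omega>\<in>space M. (\<forall>i\<in>{1..n}. subtree (\<tau> \<omega>) [i] \<in> B i) \<and> outdeg (\<tau> \<omega>) [] = n} = pmf p n * ?R"
      using True by (simp add: cond_prob_def deg field_simps)
    then show ?thesis
      by (simp only: conj_commute)
  next
    case False
    then have "pmf p n = 0"
      using pmf_nonneg[of p n] by linarith
    moreover have "prob ?E \<le> prob {\<omega>\<in>space M. outdeg (\<tau> \<omega>) [] = n}"
      using ev by (intro finite_measure_mono) auto
    ultimately have "prob ?E = 0"
      using deg measure_nonneg[of M ?E] by linarith
    then show ?thesis
      by (simp only: \<open>pmf p n = 0\<close> mult_zero_left)
  qed
qed

lemma prob_finite: "prob {\<omega>\<in>space M. \<tau> \<omega> \<in> finite_trees} = 1"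
proof -
  define q where "q = prob {\<omega>\<in>space M. \<tau> \<omega> \<in> finite_trees}"
  have q: "0 \<le> q" "q \<le> 1"
    by (auto simp: q_def)
  let ?D = "\<lambda>n. {\<omega>\<in>space M. \<tau> \<omega> \<in> {t \<in> finite_trees. outdeg t [] = n}}"
  have D: "prob (?D n) = pmf p n * q ^ n" for n
  proof -
    have "?D n = {\<omega>\<in>space M. outdeg (\<tau> \<omega>) [] = n \<and> (\<forall>i\<in>{1..n}. subtree (\<tau> \<omega>) [i] \<in> finite_trees)}"
      using tau_in_trees finite_trees_iff_subtrees by auto
    then show ?thesis
      using prob_root_decomposition[of n "\<lambda>_. finite_trees"] subset_finite_trees_in_sets[of finite_trees]
      by (simp add: q_def)
  qed
  have "?D n \<in> events" for n
    by (intro tau_event subset_finite_trees_in_sets) auto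
  then have "(\<lambda>n. prob (?D n)) sums prob (\<Union>n. ?D n)"
    by (intro finite_measure_UNION) (auto simp: disjoint_family_on_def)
  moreover have "(\<Union>n. ?D n) = {\<omega>\<in>space M. \<tau> \<omega> \<in> finite_trees}"
    by auto
  ultimately have sums: "(\<lambda>n. pmf p n * q ^ n) sums q"
    by (simp only: D q_def)
  have "(\<integral>\<^sup>+ n. ennreal (q ^ n) \<partial>measure_pmf p) = (\<integral>\<^sup>+ n. ennreal (pmf p n * q ^ n) \<partial>count_space UNIV)"
    using q by (simp add: nn_integral_measure_pmf ennreal_mult)
  also have "\<dots> = ennreal q"
    unfolding nn_integral_count_space_nat
    by (rule suminf_ennreal_eq[OF _ sums]) (use q in simp)
  finally have E_q: "measure_pmf.expectation p (\<lambda>n. q ^ n) = q"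
    using q by (subst integral_eq_nn_integral) auto
  \<comment> \<open>The gap between \<open>q ^ n\<close> and its tangent at 1: it is nonnegative, and its expectation
    vanishes because \<open>p\<close> has mean 1.\<close>
  define \<phi> where "\<phi> n = q ^ n - 1 + real n * (1 - q)" for n
  have int_q: "integrable (measure_pmf p) (\<lambda>n. q ^ n)"
    using q by (intro measure_pmf.integrable_const_bound[where B = 1]) (auto intro: power_le_one)
  have crit': "integrable (measure_pmf p) real" "measure_pmf.expectation p real = 1"
    using crit by (auto simp: critical_def)
  have \<phi>_nonneg: "0 \<le> \<phi> n" for n
    using Bernoulli_inequality[of "q - 1" n] q by (simp add: \<phi>_def algebra_simps)
  have \<phi>_int: "integrable (measure_pmf p) \<phi>"
    unfolding \<phi>_def using int_q crit'(1) by simp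
  have "measure_pmf.expectation p \<phi> = 0"
    unfolding \<phi>_def using int_q crit' by (simp add: E_q)
  then have "AE n in measure_pmf p. \<phi> n = 0"
    using integral_nonneg_eq_0_iff_AE[OF \<phi>_int] \<phi>_nonneg by simp
  moreover obtain j where j: "j \<ge> 2" "j \<in> set_pmf p"
    using ex_offspring_ge_2[OF mean_offspring p_1] by blast
  ultimately have "\<phi> j = 0"
    by (simp add: AE_measure_pmf_iff)
  then have "1 - q ^ j = real j * (1 - q)"
    by (simp add: \<phi>_def)
  from power_eq_tangent_imp_1[OF q j(1) this] show ?thesis
    by (simp add: q_def)
qed

text \<open>The law of \<open>\<tau>\<close> as a discrete distribution carried by the finite trees.\<close>
definition tree_law :: "tree pmf" where
  "tree_law = embed_pmf (\<lambda>t. if t \<in> finite_trees then prob {\<omega>\<in>space M. \<tau> \<omega> = t} else 0)"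

lemma tau_eq_event: "t \<in> finite_trees \<Longrightarrow> {\<omega>\<in>space M. \<tau> \<omega> = t} \<in> events"
  using tau_event[of "{t}"] finite_tree_in_sets by simp

lemma pmf_tree_law:
  "pmf tree_law t = (if t \<in> finite_trees then prob {\<omega>\<in>space M. \<tau> \<omega> = t} else 0)"
  unfolding tree_law_def
proof (rule pmf_embed_pmf)
  have "(\<integral>\<^sup>+ t. ennreal (if t \<in> finite_trees then prob {\<omega>\<in>space M. \<tau> \<omega> = t} else 0) \<partial>count_space UNIV)
      = (\<integral>\<^sup>+ t. emeasure M {\<omega>\<in>space M. \<tau> \<omega> = t} \<partial>count_space finite_trees)"
    by (subst nn_integral_count_space_indicator)
       (auto intro!: nn_integral_cong simp: emeasure_eq_measure indicator_def)
  also have "\<dots> = emeasure M (\<Union>t\<in>finite_trees. {\<omega>\<in>space M. \<tau> \<omega> = t})"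
    using tau_eq_event countable_finite_trees
    by (intro emeasure_UN_countable[symmetric]) (auto simp: disjoint_family_on_def)
  also have "(\<Union>t\<in>finite_trees. {\<omega>\<in>space M. \<tau> \<omega> = t}) = {\<omega>\<in>space M. \<tau> \<omega> \<in> finite_trees}"
    by auto
  finally show "(\<integral>\<^sup>+ t. ennreal (if t \<in> finite_trees then prob {\<omega>\<in>space M. \<tau> \<omega> = t} else 0) \<partial>count_space UNIV) = 1"
    by (simp add: emeasure_eq_measure prob_finite)
qed simp

lemma set_tree_law: "set_pmf tree_law \<subseteq> finite_trees"
  by (auto simp: set_pmf_eq pmf_tree_law split: if_splits)

lemma pmf_tree_law_plant:
  assumes f: "set f \<subseteq> finite_trees"
  shows "pmf tree_law (plant f) = pmf p (length f) * (\<Prod>t\<leftarrow>f. pmf tree_law t)"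
proof -
  let ?n = "length f"
  have f_tr: "set f \<subseteq> trees"
    using f finite_trees_subset by blast
  have "\<tau> \<omega> = plant f \<longleftrightarrow> outdeg (\<tau> \<omega>) [] = ?n \<and> (\<forall>i\<in>{1..?n}. subtree (\<tau> \<omega>) [i] \<in> {f ! (i - 1)})"
    (is "_ \<longleftrightarrow> ?R") if "\<omega> \<in> space M" for \<omega>
  proof
    assume "\<tau> \<omega> = plant f"
    moreover have "subtree (plant f) [i] = f ! (i - 1)" if "i \<in> {1..?n}" for i
      using that subtree_plant[of "i - 1" f] by (cases i) auto
    ultimately show ?R
      using outdeg_plant[OF f_tr] by simp
  next
    assume R: ?R
    then have "map (\<lambda>i. subtree (\<tau> \<omega>) [Suc i]) [0..<outdeg (\<tau> \<omega>) []] = f"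
      by (intro nth_equalityI) auto
    then show "\<tau> \<omega> = plant f"
      using tree_eq_plant[OF tau_in_trees[OF that]] by simp
  qed
  then have "{\<omega>\<in>space M. \<tau> \<omega> = plant f} =
      {\<omega>\<in>space M. outdeg (\<tau> \<omega>) [] = ?n \<and> (\<forall>i\<in>{1..?n}. subtree (\<tau> \<omega>) [i] \<in> {f ! (i - 1)})}"
    by blast
  moreover have fi: "f ! (i - 1) \<in> finite_trees" if "i \<in> {1..?n}" for i
    using f that by (auto intro!: subsetD[OF f] nth_mem)
  ultimately have "prob {\<omega>\<in>space M. \<tau> \<omega> = plant f} =
      pmf p ?n * (\<Prod>i\<in>{1..?n}. prob {\<omega>\<in>space M. \<tau> \<omega> \<in> {f ! (i - 1)}})"
    using prob_root_decomposition[of ?n "\<lambda>i. {f ! (i - 1)}"] finite_tree_in_sets by simp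
  also have "(\<Prod>i\<in>{1..?n}. prob {\<omega>\<in>space M. \<tau> \<omega> \<in> {f ! (i - 1)}}) = (\<Prod>i\<in>{1..?n}. pmf tree_law (f ! (i - 1)))"
    using fi by (intro prod.cong) (auto simp: pmf_tree_law)
  also have "\<dots> = (\<Prod>i<?n. pmf tree_law (f ! i))"
    by (simp add: prod.atLeast1_atMost_eq)
  also have "\<dots> = (\<Prod>t\<leftarrow>f. pmf tree_law t)"
    by (simp add: prod.list_conv_set_nth atLeast0LessThan)
  finally show ?thesis
    using plant_in_finite_trees[OF f] by (simp add: pmf_tree_law)
qed

lemma tree_law_eq:
  "tree_law = bind_pmf p (\<lambda>k. map_pmf plant (replicate_pmf k tree_law))" (is "_ = ?N")
proof (rule pmf_eqI)
  fix t
  have fin: "set g \<subseteq> finite_trees" if "g \<in> set_pmf (replicate_pmf k tree_law)" for g k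
    using that set_tree_law by (auto simp: set_replicate_pmf)
  show "pmf tree_law t = pmf ?N t"
  proof (cases "t \<in> finite_trees")
    case False
    moreover have "pmf ?N t = 0"
      unfolding pmf_eq_0_set_pmf using False fin plant_in_finite_trees by auto
    ultimately show ?thesis
      by (simp add: pmf_tree_law)
  next
    case True
    then obtain f where f: "set f \<subseteq> finite_trees" "t = plant f"
      by (rule finite_tree_cases)
    have "pmf (map_pmf plant (replicate_pmf k tree_law)) t = pmf (replicate_pmf k tree_law) f" for k
    proof -
      have "plant g = plant f \<longleftrightarrow> g = f" if "g \<in> set_pmf (replicate_pmf k tree_law)" for g
        using fin[OF that] f(1) finite_trees_subset by (intro plant_inject) auto
      then have "measure_pmf.prob (replicate_pmf k tree_law) (plant -` {plant f}) =
          measure_pmf.prob (replicate_pmf k tree_law) {f}"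
        by (intro measure_pmf.finite_measure_eq_AE AE_pmfI) auto
      then show ?thesis
        by (simp add: pmf_map f(2) measure_pmf_single)
    qed
    then have "pmf ?N t = measure_pmf.expectation p (\<lambda>k. pmf (replicate_pmf k tree_law) f)"
      by (simp add: pmf_bind)
    also have "\<dots> = measure_pmf.expectation p (\<lambda>k. indicator {length f} k * (\<Prod>t\<leftarrow>f. pmf tree_law t))"
      by (intro Bochner_Integration.integral_cong) (auto simp: pmf_replicate_pmf)
    also have "\<dots> = pmf p (length f) * (\<Prod>t\<leftarrow>f. pmf tree_law t)"
      by (simp add: measure_pmf_single)
    finally show ?thesis
      using pmf_tree_law_plant[OF f(1)] f(2) by simp
  qed
qed

lemma prob_tau_in:
  assumes "B \<subseteq> finite_trees"
  shows "prob {\<omega>\<in>space M. \<tau> \<omega> \<in> B} = measure_pmf.prob tree_law B"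
  using countable_finite_trees assms tau_eq_event
  by (rule prob_in_countable) (auto simp: pmf_tree_law)

text \<open>The event \<open>{P \<tau>}\<close> need not be assumed measurable: a non-measurable set has measure 0.\<close>
lemma prob_tau_pos:
  assumes "0 < prob {\<omega>\<in>space M. P (\<tau> \<omega>)}"
  shows "0 < measure_pmf.prob tree_law {t. P t}"
proof -
  have ev: "{\<omega>\<in>space M. P (\<tau> \<omega>)} \<in> events"
    using assms measure_notin_sets[of "{\<omega>\<in>space M. P (\<tau> \<omega>)}" M] by (cases "{\<omega>\<in>space M. P (\<tau> \<omega>)} \<in> events") auto
  have "AE \<omega> in M. \<omega> \<in> {\<omega>\<in>space M. \<tau> \<omega> \<in> finite_trees}"
    using prob_finite tau_event[OF subset_finite_trees_in_sets[OF order_refl]]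
    by (intro prob_eq_1[THEN iffD1]) auto
  then have "prob {\<omega>\<in>space M. P (\<tau> \<omega>)} = prob {\<omega>\<in>space M. \<tau> \<omega> \<in> {t \<in> finite_trees. P t}}"
    using ev by (intro finite_measure_eq_AE tau_event subset_finite_trees_in_sets) auto
  also have "\<dots> = measure_pmf.prob tree_law {t \<in> finite_trees. P t}"
    by (rule prob_tau_in) auto
  also have "\<dots> \<le> measure_pmf.prob tree_law {t. P t}"
    by (rule measure_pmf.finite_measure_mono) auto
  finally show ?thesis
    using assms by simp
qed

lemma tail_tree: "tail M A (\<lambda>\<omega>. [\<tau> \<omega>]) (int n) = measure_pmf.prob tree_law {t. n < A [t]}"
proof -
  have "tail M A (\<lambda>\<omega>. [\<tau> \<omega>]) (int n) = prob {\<omega>\<in>space M. \<tau> \<omega> \<in> {t \<in> finite_trees. n < A [t]}}"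
    by (simp add: tail_def)
  also have "\<dots> = measure_pmf.prob tree_law {t \<in> finite_trees. n < A [t]}"
    by (rule prob_tau_in) auto
  also have "\<dots> = measure_pmf.prob tree_law {t. n < A [t]}"
    using set_tree_law by (intro measure_pmf.finite_measure_eq_AE AE_pmfI) auto
  finally show ?thesis .
qed

lemma tail_forest:
  assumes k: "k \<ge> 1" and iid: "iid_copies M \<tau> k \<sigma>"
  shows "tail M A (forest_of k \<sigma>) (int n) = measure_pmf.prob (replicate_pmf k tree_law) {f. n < A f}"
proof -
  have indep: "indep_vars (\<lambda>_. tree_space) \<sigma> {1..k}"
    and same: "distr M tree_space (\<sigma> i) = distr M tree_space \<tau>" if "i \<in> {1..k}" for i
    using iid that by (auto simp: iid_copies_def)
  have rv: "\<sigma> i \<in> measurable M tree_space" if "i \<in> {1..k}" for i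
    using indep k that by (auto simp: indep_vars_def2)
  have ev: "\<sigma> i -` B \<inter> space M \<in> events" if "i \<in> {1..k}" "B \<in> sets tree_space" for i B
    using rv[OF that(1)] that(2) by (rule measurable_sets)
  have pr: "prob (\<sigma> i -` {t} \<inter> space M) = pmf tree_law t" if "i \<in> {1..k}" "t \<in> finite_trees" for i t
  proof -
    have "prob (\<sigma> i -` {t} \<inter> space M) = measure (distr M tree_space (\<sigma> i)) {t}"
      using rv that finite_tree_in_sets by (simp add: measure_distr)
    also have "\<dots> = prob (\<tau> -` {t} \<inter> space M)"
      using random_tree that finite_tree_in_sets by (simp add: same measure_distr)
    also have "\<tau> -` {t} \<inter> space M = {\<omega>\<in>space M. \<tau> \<omega> = t}"
      by auto
    finally show ?thesis
      using that by (simp add: pmf_tree_law)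
  qed
  define C where "C = {f. set f \<subseteq> finite_trees \<and> length f = k}"
  have "countable (lists finite_trees)"
    using countable_finite_trees by (rule countable_lists)
  then have "countable C"
    by (rule countable_subset[rotated]) (auto simp: C_def)
  have nth_C: "f ! (i - 1) \<in> finite_trees" if "f \<in> C" "i \<in> {1..k}" for f i
    using that nth_mem[of "i - 1" f] by (auto simp: C_def)
  have forest_eq: "{\<omega>\<in>space M. forest_of k \<sigma> \<omega> = f} = (\<Inter>i\<in>{1..k}. \<sigma> i -` {f ! (i - 1)} \<inter> space M)"
    if "f \<in> C" for f
  proof -
    have "forest_of k \<sigma> \<omega> = f \<longleftrightarrow> (\<forall>i\<in>{1..k}. \<sigma> i \<omega> = f ! (i - 1))" for \<omega>
    proof -
      have "forest_of k \<sigma> \<omega> = f \<longleftrightarrow> (\<forall>j<k. \<sigma> (Suc j) \<omega> = f ! j)"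
        using that by (auto simp: forest_of_def list_eq_iff_nth_eq C_def simp del: upt_Suc)
      also have "\<dots> \<longleftrightarrow> (\<forall>i\<in>{1..k}. \<sigma> i \<omega> = f ! (i - 1))"
        unfolding image_Suc_lessThan[symmetric] by auto
      finally show ?thesis .
    qed
    then show ?thesis
      using k by auto
  qed
  have "tail M A (forest_of k \<sigma>) (int n) =
      prob {\<omega>\<in>space M. forest_of k \<sigma> \<omega> \<in> {f \<in> C. n < A f}}"
    by (simp add: tail_def C_def forest_of_def del: upt_Suc)
  also have "\<dots> = measure_pmf.prob (replicate_pmf k tree_law) {f \<in> C. n < A f}"
  proof (rule prob_in_countable[OF \<open>countable C\<close>])
    fix f assume f: "f \<in> C"
    show "{\<omega>\<in>space M. forest_of k \<sigma> \<omega> = f} \<in> events"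
      unfolding forest_eq[OF f] using k nth_C[OF f] finite_tree_in_sets
      by (intro sets.finite_INT ev) auto
    have "prob {\<omega>\<in>space M. forest_of k \<sigma> \<omega> = f} = (\<Prod>i\<in>{1..k}. prob (\<sigma> i -` {f ! (i - 1)} \<inter> space M))"
      unfolding forest_eq[OF f]
    proof (rule indep_setsD)
      show "indep_sets (\<lambda>i. {\<sigma> i -` B \<inter> space M |B. B \<in> sets tree_space}) {1..k}"
        using indep k by (auto simp: indep_vars_def2)
    qed (use k nth_C[OF f] finite_tree_in_sets in auto)
    also have "\<dots> = (\<Prod>i\<in>{1..k}. pmf tree_law (f ! (i - 1)))"
      using nth_C[OF f] by (intro prod.cong pr) auto
    also have "\<dots> = (\<Prod>i<k. pmf tree_law (f ! i))"
      by (simp add: prod.atLeast1_atMost_eq)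
    also have "\<dots> = pmf (replicate_pmf k tree_law) f"
      using f by (simp add: C_def pmf_replicate_pmf prod.list_conv_set_nth atLeast0LessThan)
    finally show "prob {\<omega>\<in>space M. forest_of k \<sigma> \<omega> = f} = pmf (replicate_pmf k tree_law) f" .
  qed auto
  also have "\<dots> = measure_pmf.prob (replicate_pmf k tree_law) {f. n < A f}"
    using set_tree_law by (intro measure_pmf.finite_measure_eq_AE AE_pmfI) (auto simp: C_def set_replicate_pmf)
  finally show ?thesis .
qed

end

section \<open>The two limits\<close>

theorem theorem2p7:
  fixes p :: "nat pmf" and M :: "'a measure"
    and \<tau> :: "'a \<Rightarrow> tree" and \<sigma> :: "nat \<Rightarrow> nat \<Rightarrow> 'a \<Rightarrow> tree"
    and A :: "forest \<Rightarrow> nat"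
  assumes "prob_space M"
    and "critical p" and "pmf p 1 \<noteq> 1"
    and "galton_watson p M \<tau>"
    and "\<And>k. k \<ge> 1 \<Longrightarrow> iid_copies M \<tau> k (\<sigma> k)"
    and "\<And>n::nat. tail M A (\<lambda>\<omega>. [\<tau> \<omega>]) (int n) > 0"
    and "monotone_functional A"
  shows "(\<forall>k\<ge>1. accessible_size M \<tau> A k \<longrightarrow>
      (\<lambda>n. tail M A (forest_of k (\<sigma> k)) (int n) / tail M A (\<lambda>\<omega>. [\<tau> \<omega>]) (int n))
        \<longlonglongrightarrow> real k)
    \<and> (eventually_additive M \<tau> A \<longrightarrow>
      (\<forall>k\<ge>1. \<forall>r\<ge>1. accessible_size M \<tau> A k \<longrightarrow>
        (\<lambda>n. tail M A (forest_of k (\<sigma> k)) (int n - int r)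
            / tail M A (forest_of k (\<sigma> k)) (int n)) \<longlonglongrightarrow> 1))"
proof -
  interpret critical_galton_watson M p \<tau>
    using assms(1-4) by (simp add: critical_galton_watson_def critical_galton_watson_axioms_def)
  interpret monotone_tree_functional p tree_law A
  proof
    show "set_pmf tree_law \<subseteq> finite_trees"
      by (rule set_tree_law)
    show "tree_law = p \<bind> (\<lambda>k. map_pmf plant (replicate_pmf k tree_law))"
      by (rule tree_law_eq)
    show "0 < measure_pmf.prob tree_law {t. n < A [t]}" for n
      using assms(6)[of n] by (simp add: tail_tree)
  qed (fact mean_offspring assms)+
  have tau_tail: "tail M A (\<lambda>\<omega>. [\<tau> \<omega>]) (int n) = tree_tail n" for n
    by (simp add: tail_tree tree_tail_def)
  have sigma_tail: "tail M A (forest_of k (\<sigma> k)) (int n) = forest_tail k n" if "k \<ge> 1" for k n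
    using tail_forest[OF that assms(5)[OF that]] by (simp add: forest_tail_def)
  have ratio: "(\<lambda>n. forest_tail k n / tree_tail n) \<longlonglongrightarrow> real k"
    if k: "k \<ge> 1" and acc: "accessible_size M \<tau> A k" for k
    using acc unfolding accessible_size_def
  proof
    assume "\<exists>b. 0 < prob {\<omega>\<in>space M. Y_at b (\<tau> \<omega>) = k}"
    then obtain b where "0 < prob {\<omega>\<in>space M. Y_at b (\<tau> \<omega>) = k}"
      by blast
    then have b: "0 < measure_pmf.prob tree_law {t. Y_at b t = k}"
      by (rule prob_tau_pos)
    \<comment> \<open>Monotonicity is available from height 1 on; the generation at height 0 has exactly one
      node, and for a single tree the ratio is constant.\<close>
    show ?thesis
    proof (cases "b = 0")
      case True
      obtain t where t: "t \<in> set_pmf tree_law" "Y_at 0 t = k"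
        using b measure_pmf_zero_iff[of tree_law "{t. Y_at b t = k}"] True by force
      then have "k = 1"
        using above_0[of t] length_above[of 0 t] set_tree_law finite_trees_subset by auto
      moreover have "tree_tail n \<noteq> 0" for n
        using tree_tail_pos[of n] by simp
      ultimately show ?thesis
        by (simp add: forest_tail_1[unfolded One_nat_def])
    next
      case False
      then show ?thesis
        using forest_tail_ratio_generation[OF k _ b] by simp
    qed
  next
    assume "\<forall>f g. set f \<subseteq> finite_trees \<longrightarrow> set g \<subseteq> finite_trees \<longrightarrow> f \<noteq> [] \<longrightarrow> A f \<le> A (f @ g)"
    then show ?thesis
      using forest_tail_ratio_extendable[OF k] by blast
  qed
  have shift: "(\<lambda>n. tail M A (forest_of k (\<sigma> k)) (int n - int r)
      / tail M A (forest_of k (\<sigma> k)) (int n)) \<longlonglongrightarrow> 1"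
    if add: "eventually_additive M \<tau> A" and k: "k \<ge> 1" and acc: "accessible_size M \<tau> A k" for k r
  proof -
    obtain b s n0 and r0 :: int where b: "b \<ge> 1" and r0: "r0 > 0" and Y: "Y_at b s \<ge> 1"
      and pos: "0 < prob {\<omega>\<in>space M. truncate b (\<tau> \<omega>) = s}"
      and eq: "\<forall>t\<in>finite_trees. truncate b t = s \<longrightarrow> n0 \<le> A [t] \<longrightarrow>
        int (A [t]) - int (A (above b t)) = r0"
      using add unfolding eventually_additive_def by (elim exE bexE conjE) (rule that)
    have incr: "A [t] = A (above b t) + nat r0" if "t \<in> finite_trees" "truncate b t = s" "n0 \<le> A [t]" for t
      using eq that r0 by fastforce
    have "(\<lambda>n. tree_tail (n - nat r0) / tree_tail n) \<longlonglongrightarrow> 1"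
      by (rule tree_tail_shift_by_increment[OF b Y prob_tau_pos[where P = "\<lambda>t. truncate b t = s", OF pos] incr])
    then have "(\<lambda>n. tree_tail (n - r) / tree_tail n) \<longlonglongrightarrow> 1"
      by (rule tree_tail_shift) (use r0 in simp)
    from forest_tail_shift[OF k ratio[OF k acc] this]
    show ?thesis
    proof (rule Lim_transform_eventually)
      show "eventually (\<lambda>n. forest_tail k (n - r) / forest_tail k n =
          tail M A (forest_of k (\<sigma> k)) (int n - int r) / tail M A (forest_of k (\<sigma> k)) (int n)) sequentially"
        using eventually_ge_at_top[of r]
      proof eventually_elim
        case (elim n)
        then have "int n - int r = int (n - r)"
          by simp
        then show ?case
          using sigma_tail[OF k] by metis
      qed
    qed
  qed
  show ?thesis
    using ratio shift by (auto simp: sigma_tail tau_tail)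
qed

end
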